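(* Let $\gamma$ and $\delta$ be two closed geodesics in an orientable hyperbolic surface. Then the intersection angles of $\gamma$ and $\delta$ are larger than $$2\,\Pi\left(\frac{l(\gamma)+l(\delta)}{2}\right).$$
   Context: A hyperbolic surface is a surface $M=\mathbb{H}^2/\pi_1(M)$ with $\pi_1(M)$ a discrete torsion-free group of isometries of $\mathbb{H}^2$. $l(\cdot)$ denotes length. The intersection angles are the angles formed by arcs of $\gamma$ and $\delta$ at points where they cross transversely. For $a>0$, $\Pi(a)$ is the angle of parallelism: the third angle of a right hyperbolic triangle which has two asymptotically parallel sides and a finite side of length $a$; equivalently $\Pi(a)=2\arctan(e^{-a})$. *)

theory Defs
  imports "HOL-Analysis.Analysis"
begin

section \<open>The hyperbolic plane\<close>

typedef hyp_plane = "{z :: complex. Im z > 0}"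
  morphisms to_complex of_complex
  by (rule exI[of _ \<i>]) simp

text \<open>
  The upper half-plane model: the distance function of the Riemannian metric
  \<open>(dx\<^sup>2 + dy\<^sup>2) / y\<^sup>2\<close> is given by
  \<open>cosh (d(z, w)) = 1 + |z - w|\<^sup>2 / (2 Im z Im w)\<close>.
\<close>

definition cosh_dist :: "hyp_plane \<Rightarrow> hyp_plane \<Rightarrow> real" where
  "cosh_dist p q = 1 + (cmod (to_complex p - to_complex q))\<^sup>2 /
     (2 * Im (to_complex p) * Im (to_complex q))"

lemma Im_to_complex: "Im (to_complex p) > 0"
  using to_complex[of p] by simp

lemma cosh_dist_ge_1: "cosh_dist p q \<ge> 1"
  using Im_to_complex[of p] Im_to_complex[of q] by (simp add: cosh_dist_def)

lemma cosh_dist_commute: "cosh_dist p q = cosh_dist q p"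
  by (simp add: cosh_dist_def norm_minus_commute mult_ac)

lemma cosh_dist_eq_1_iff: "cosh_dist p q = 1 \<longleftrightarrow> p = q"
  using Im_to_complex[of p] Im_to_complex[of q]
  by (auto simp: cosh_dist_def to_complex_inject)

lemma cosh_dist_mult:
  "cosh_dist p q * (2 * Im (to_complex p) * Im (to_complex q)) =
     (Re (to_complex p) - Re (to_complex q))\<^sup>2 + (Im (to_complex p))\<^sup>2 + (Im (to_complex q))\<^sup>2"
proof -
  have "cosh_dist p q * (2 * Im (to_complex p) * Im (to_complex q)) =
      2 * Im (to_complex p) * Im (to_complex q) + (cmod (to_complex p - to_complex q))\<^sup>2"
    using Im_to_complex[of p] Im_to_complex[of q] by (simp add: cosh_dist_def distrib_right)
  then show ?thesis
    unfolding cmod_power2 by (simp add: power2_eq_square algebra_simps)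
qed

text \<open>
  In the hyperboloid model \<open>cosh_dist\<close> is minus the Lorentz form, so the Gram determinant
  of three points is minus the square of the determinant of their coordinates.
\<close>

lemma cosh_dist_Gram:
  "(cosh_dist p r - cosh_dist p q * cosh_dist q r)\<^sup>2
     \<le> ((cosh_dist p q)\<^sup>2 - 1) * ((cosh_dist q r)\<^sup>2 - 1)"
proof -
  obtain a b where p: "to_complex p = Complex a b" by (cases "to_complex p")
  obtain c d where q: "to_complex q = Complex c d" by (cases "to_complex q")
  obtain e f where r: "to_complex r = Complex e f" by (cases "to_complex r")
  have pos: "b > 0" "d > 0" "f > 0"
    using Im_to_complex[of p] Im_to_complex[of q] Im_to_complex[of r] p q r by auto
  define A where "A = cosh_dist p q"
  define B where "B = cosh_dist q r"
  define C where "C = cosh_dist p r"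
  have A: "A * (2 * b * d) = (a - c)\<^sup>2 + b\<^sup>2 + d\<^sup>2"
    using cosh_dist_mult[of p q] by (simp add: A_def p q)
  have B: "B * (2 * d * f) = (c - e)\<^sup>2 + d\<^sup>2 + f\<^sup>2"
    using cosh_dist_mult[of q r] by (simp add: B_def q r)
  have C: "C * (2 * b * f) = (a - e)\<^sup>2 + b\<^sup>2 + f\<^sup>2"
    using cosh_dist_mult[of p r] by (simp add: C_def p r)
  define D where "D = (a\<^sup>2 + b\<^sup>2) * (c - e) + (c\<^sup>2 + d\<^sup>2) * (e - a) + (e\<^sup>2 + f\<^sup>2) * (a - c)"
  have "(2 * b * d * f)\<^sup>2 * (1 + 2 * A * B * C - A\<^sup>2 - B\<^sup>2 - C\<^sup>2)
      = 4 * (b * d * f)\<^sup>2 + (A * (2 * b * d)) * (B * (2 * d * f)) * (C * (2 * b * f))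
        - (A * (2 * b * d))\<^sup>2 * f\<^sup>2 - (B * (2 * d * f))\<^sup>2 * b\<^sup>2 - (C * (2 * b * f))\<^sup>2 * d\<^sup>2"
    by algebra
  also have "\<dots> = D\<^sup>2"
    unfolding A B C D_def by algebra
  finally have "(2 * b * d * f)\<^sup>2 * (1 + 2 * A * B * C - A\<^sup>2 - B\<^sup>2 - C\<^sup>2) \<ge> 0"
    by simp
  moreover have "(2 * b * d * f)\<^sup>2 > 0"
    using pos by simp
  ultimately have "1 + 2 * A * B * C - A\<^sup>2 - B\<^sup>2 - C\<^sup>2 \<ge> 0"
    by (simp add: zero_le_mult_iff)
  moreover have "(A\<^sup>2 - 1) * (B\<^sup>2 - 1) - (C - A * B)\<^sup>2 = 1 + 2 * A * B * C - A\<^sup>2 - B\<^sup>2 - C\<^sup>2"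
    by algebra
  ultimately show ?thesis
    by (simp add: A_def B_def C_def)
qed

instantiation hyp_plane :: metric_space
begin

definition dist_hyp_plane :: "hyp_plane \<Rightarrow> hyp_plane \<Rightarrow> real" where
  "dist p q = arcosh (cosh_dist p q)"

definition uniformity_hyp_plane :: "(hyp_plane \<times> hyp_plane) filter" where
  "uniformity_hyp_plane = (INF e\<in>{0<..}. principal {(x, y). dist x y < e})"

definition open_hyp_plane :: "hyp_plane set \<Rightarrow> bool" where
  "open_hyp_plane U \<longleftrightarrow> (\<forall>x\<in>U. eventually (\<lambda>(x', y). x' = x \<longrightarrow> y \<in> U) uniformity)"

instance
proof
  fix p q r :: hyp_plane
  show "dist p q = 0 \<longleftrightarrow> p = q"
    by (simp add: dist_hyp_plane_def cosh_dist_ge_1 cosh_dist_eq_1_iff)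
  show "dist p q \<le> dist p r + dist q r"
  proof -
    let ?A = "cosh_dist p r" and ?B = "cosh_dist q r" and ?C = "cosh_dist p q"
    have "(?C - ?A * ?B)\<^sup>2 \<le> (?A\<^sup>2 - 1) * (?B\<^sup>2 - 1)"
      using cosh_dist_Gram[of p q r] by (simp add: cosh_dist_commute)
    then have "?C - ?A * ?B \<le> sqrt ((?A\<^sup>2 - 1) * (?B\<^sup>2 - 1))"
      by (rule real_le_rsqrt)
    also have "\<dots> = sinh (arcosh ?A) * sinh (arcosh ?B)"
      by (simp add: sinh_arcosh_real cosh_dist_ge_1 real_sqrt_mult)
    finally have "?C \<le> cosh (arcosh ?A + arcosh ?B)"
      by (simp add: cosh_add cosh_dist_ge_1)
    then have "arcosh ?C \<le> arcosh (cosh (arcosh ?A + arcosh ?B))"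
      using cosh_dist_ge_1[of p q] cosh_real_ge_1
      by (metis arcosh_less_iff_real linorder_not_le)
    then show ?thesis
      by (simp add: dist_hyp_plane_def arcosh_cosh_real cosh_dist_ge_1)
  qed
qed (rule uniformity_hyp_plane_def open_hyp_plane_def)+

end

section \<open>Hyperbolic surfaces\<close>

definition isometry :: "(hyp_plane \<Rightarrow> hyp_plane) \<Rightarrow> bool" where
  "isometry f \<longleftrightarrow> bij f \<and> (\<forall>p q. dist (f p) (f q) = dist p q)"

text \<open>
  The Jacobian determinant of a real-linear map \<open>D\<close> of the complex plane
  is \<open>Im (cnj (D 1) * D \<i>)\<close>.
\<close>

definition orientation_preserving :: "(hyp_plane \<Rightarrow> hyp_plane) \<Rightarrow> bool" where
  "orientation_preserving f \<longleftrightarrow>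
     (\<forall>p. \<exists>D. ((\<lambda>z. to_complex (f (of_complex z))) has_derivative D) (at (to_complex p)) \<and>
          Im (cnj (D 1) * D \<i>) > 0)"

text \<open>
  A hyperbolic surface is the quotient of the hyperbolic plane by a group \<open>\<Gamma>\<close> as below.
  Here \<open>discrete\<close> refers to the topology of pointwise convergence on functions, which on
  isometries is the compact-open topology. The quotient is orientable iff all elements
  of \<open>\<Gamma>\<close> preserve the orientation of the plane.
\<close>

definition isometry_group :: "(hyp_plane \<Rightarrow> hyp_plane) set \<Rightarrow> bool" where
  "isometry_group \<Gamma> \<longleftrightarrow> (\<forall>g\<in>\<Gamma>. isometry g) \<and> id \<in> \<Gamma> \<and>
     (\<forall>g\<in>\<Gamma>. \<forall>h\<in>\<Gamma>. g \<circ> h \<in> \<Gamma>) \<and> (\<forall>g\<in>\<Gamma>. inv g \<in> \<Gamma>)"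

definition torsion_free :: "(hyp_plane \<Rightarrow> hyp_plane) set \<Rightarrow> bool" where
  "torsion_free \<Gamma> \<longleftrightarrow> (\<forall>g\<in>\<Gamma>. \<forall>n>0. g ^^ n = id \<longrightarrow> g = id)"

definition hyperbolic_surface_group :: "(hyp_plane \<Rightarrow> hyp_plane) set \<Rightarrow> bool" where
  "hyperbolic_surface_group \<Gamma> \<longleftrightarrow> isometry_group \<Gamma> \<and> discrete \<Gamma> \<and> torsion_free \<Gamma>"

definition orientable_hyperbolic_surface_group :: "(hyp_plane \<Rightarrow> hyp_plane) set \<Rightarrow> bool" where
  "orientable_hyperbolic_surface_group \<Gamma> \<longleftrightarrow>
     hyperbolic_surface_group \<Gamma> \<and> (\<forall>g\<in>\<Gamma>. orientation_preserving g)"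

text \<open>The points of the surface are the \<open>\<Gamma>\<close>-orbits.\<close>

definition surface_proj :: "(hyp_plane \<Rightarrow> hyp_plane) set \<Rightarrow> hyp_plane \<Rightarrow> hyp_plane set" where
  "surface_proj \<Gamma> p = (\<lambda>g. g p) ` \<Gamma>"

section \<open>Closed geodesics and their intersection angles\<close>

text \<open>
  Complete geodesics of the plane, parametrized by arc length. In the hyperbolic plane
  all geodesics are globally length minimizing.
\<close>

definition geodesic_line :: "(real \<Rightarrow> hyp_plane) \<Rightarrow> bool" where
  "geodesic_line \<sigma> \<longleftrightarrow> (\<forall>s t. dist (\<sigma> s) (\<sigma> t) = \<bar>s - t\<bar>)"

text \<open>
  The projection is a locally isometric covering, so the geodesics of the surface
  are the curves that lift to geodesics of the plane.
\<close>

definition geodesic_lift ::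
    "(hyp_plane \<Rightarrow> hyp_plane) set \<Rightarrow> (real \<Rightarrow> hyp_plane set) \<Rightarrow> (real \<Rightarrow> hyp_plane) \<Rightarrow> bool" where
  "geodesic_lift \<Gamma> \<gamma> \<sigma> \<longleftrightarrow> geodesic_line \<sigma> \<and> \<gamma> = surface_proj \<Gamma> \<circ> \<sigma>"

text \<open>
  A closed geodesic of length \<open>l\<close>: an arc-length parametrized geodesic of period \<open>l\<close>, that is,
  a geodesic defined on the circle of length \<open>l\<close>. The period need not be minimal,
  so geodesics that run several times through the same loop are included.
\<close>

definition closed_geodesic ::
    "(hyp_plane \<Rightarrow> hyp_plane) set \<Rightarrow> (real \<Rightarrow> hyp_plane set) \<Rightarrow> real \<Rightarrow> bool" where
  "closed_geodesic \<Gamma> \<gamma> l \<longleftrightarrow>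
     (\<exists>\<sigma>. geodesic_lift \<Gamma> \<gamma> \<sigma>) \<and> l > 0 \<and> (\<forall>t. \<gamma> (t + l) = \<gamma> t)"

text \<open>
  The half-plane model is conformal, so hyperbolic angles between tangent vectors
  are Euclidean angles.
\<close>

definition vector_angle :: "complex \<Rightarrow> complex \<Rightarrow> real" where
  "vector_angle u v = arccos ((u \<bullet> v) / (norm u * norm v))"

definition velocity :: "(real \<Rightarrow> hyp_plane) \<Rightarrow> real \<Rightarrow> complex" where
  "velocity \<sigma> t = vector_derivative (\<lambda>x. to_complex (\<sigma> x)) (at t)"

text \<open>
  At a common point of \<open>\<gamma>\<close> and \<open>\<delta>\<close> there are lifts that pass through the same point of the plane;
  the crossing is transverse if their tangents are linearly independent. Two arcs of
  \<open>\<gamma>\<close> and two arcs of \<open>\<delta>\<close> emanate from the point, which is why \<open>v\<close> occurs with both signs.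
  The case \<open>\<gamma> = \<delta>\<close> yields the angles of self-intersection.
\<close>

definition intersection_angle ::
    "(hyp_plane \<Rightarrow> hyp_plane) set \<Rightarrow> (real \<Rightarrow> hyp_plane set) \<Rightarrow> (real \<Rightarrow> hyp_plane set) \<Rightarrow> real \<Rightarrow> bool" where
  "intersection_angle \<Gamma> \<gamma> \<delta> \<theta> \<longleftrightarrow>
     (\<exists>\<sigma> \<tau> s t u v. geodesic_lift \<Gamma> \<gamma> \<sigma> \<and> geodesic_lift \<Gamma> \<delta> \<tau> \<and> \<sigma> s = \<tau> t \<and>
        u = velocity \<sigma> s \<and> v = velocity \<tau> t \<and> \<not> collinear {0, u, v} \<and>
        (\<theta> = vector_angle u v \<or> \<theta> = vector_angle u (- v)))"

section \<open>The angle of parallelism\<close>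

definition parallelism_angle :: "real \<Rightarrow> real" where
  "parallelism_angle a = 2 * arctan (exp (- a))"

text \<open>
  The triangle with vertices \<open>\<i>\<close>, \<open>cis \<phi>\<close> and \<open>\<infinity>\<close>, whose sides lie on the unit circle and
  on two vertical lines, has a right angle at \<open>\<i>\<close> and the angle \<open>\<phi>\<close> at \<open>cis \<phi>\<close>.
\<close>

lemma parallelism_angle_triangle:
  assumes "0 < \<phi>" "\<phi> < pi / 2"
  shows "parallelism_angle (dist (of_complex \<i>) (of_complex (cis \<phi>))) = \<phi>"
    and "vector_angle (\<i> * cis \<phi>) \<i> = \<phi>"
proof -
  have s: "sin \<phi> > 0" and c: "cos \<phi> > 0"
    using assms by (auto intro: sin_gt_zero cos_gt_zero)
  have tc: "to_complex (of_complex \<i>) = \<i>" "to_complex (of_complex (cis \<phi>)) = cis \<phi>"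
    using s by (auto intro!: of_complex_inverse)
  have n: "(cmod (\<i> - cis \<phi>))\<^sup>2 = 2 - 2 * sin \<phi>"
    using sin_cos_squared_add[of \<phi>] by (simp add: cmod_def power2_eq_square algebra_simps)
  have C: "cosh_dist (of_complex \<i>) (of_complex (cis \<phi>)) = 1 / sin \<phi>"
    unfolding cosh_dist_def tc n using s by (simp add: field_simps)
  define x where "x = \<phi> / 2"
  have ph: "\<phi> = 2 * x" by (simp add: x_def)
  have x: "0 < x" "x < pi / 2" using assms by (auto simp: x_def)
  have sx: "sin x > 0" "cos x > 0"
    using x by (auto intro: sin_gt_zero cos_gt_zero)
  have sq: "sqrt ((1 / sin \<phi>)\<^sup>2 - 1) = cos \<phi> / sin \<phi>"
  proof -
    have "(1 / sin \<phi>)\<^sup>2 - 1 = (cos \<phi> / sin \<phi>)\<^sup>2"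
      using s sin_cos_squared_add[of \<phi>] by (simp add: field_simps)
    then show ?thesis using s c by simp
  qed
  have "dist (of_complex \<i>) (of_complex (cis \<phi>)) = ln (1 / sin \<phi> + cos \<phi> / sin \<phi>)"
    using cosh_dist_ge_1[of "of_complex \<i>" "of_complex (cis \<phi>)"]
    by (simp add: dist_hyp_plane_def C arcosh_real_def sq)
  moreover have "1 / sin \<phi> + cos \<phi> / sin \<phi> = cos x / sin x"
  proof -
    have "1 + cos \<phi> = 2 * cos x * cos x" "sin \<phi> = 2 * sin x * cos x"
      by (simp_all only: ph sin_double cos_double_cos power2_eq_square)
    then show ?thesis using sx by (simp flip: add_divide_distrib)
  qed
  ultimately have "exp (- dist (of_complex \<i>) (of_complex (cis \<phi>))) = tan x"
    using sx by (simp add: exp_minus tan_def)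
  then show "parallelism_angle (dist (of_complex \<i>) (of_complex (cis \<phi>))) = \<phi>"
    using x by (simp add: parallelism_angle_def arctan_tan ph)
  show "vector_angle (\<i> * cis \<phi>) \<i> = \<phi>"
    using assms by (simp add: vector_angle_def norm_mult inner_complex_def arccos_cos)
qed

end

theory Submission
  imports Defs
begin

text \<open>
  Let \<open>g\<close> and \<open>h\<close> be the deck transformations that translate along lifts of the two geodesics
  through a common point \<open>p\<close>, and let \<open>a\<close> and \<open>b\<close> be the points at distance \<open>l\<^sub>\<gamma> / 2\<close> and
  \<open>l\<^sub>\<delta> / 2\<close> from \<open>p\<close> on these lifts. In terms of half turns, \<open>g = R\<^sub>a R\<^sub>p\<close> and \<open>h = R\<^sub>b R\<^sub>p\<close>,
  so \<open>g h\<^sup>-\<^sup>1 g\<^sup>-\<^sup>1 h = (R\<^sub>a R\<^sub>b R\<^sub>p)\<^sup>2\<close>, and \<open>R\<^sub>a R\<^sub>b R\<^sub>p\<close> has trace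
  \<open>\<plusminus> 2 sinh (l\<^sub>\<gamma> / 2) sinh (l\<^sub>\<delta> / 2) sin \<theta>\<close>. It cannot be elliptic, because a nontrivial element
  of a discrete torsion-free group has no fixed point. Hence
  \<open>sinh (l\<^sub>\<gamma> / 2) sinh (l\<^sub>\<delta> / 2) sin \<theta> \<ge> 1\<close>, which implies the bound on \<open>\<theta>\<close>.
\<close>

section \<open>Moebius transformations\<close>

text \<open>The quotient lies in the half-plane only for positive determinant, and
  \<open>of_complex\<close> is unspecified elsewhere; hence the recurring assumption
  \<open>a * d - b * c = 1\<close>.\<close>

definition mobius :: "real \<Rightarrow> real \<Rightarrow> real \<Rightarrow> real \<Rightarrow> hyp_plane \<Rightarrow> hyp_plane" where
  "mobius a b c d p = of_complex ((of_real a * to_complex p + of_real b) / (of_real c * to_complex p + of_real d))"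

lemma mobius_denominator_nonzero:
  fixes a b c d :: real
  assumes "a * d - b * c = 1" "Im z > 0"
  shows "of_real c * z + of_real d \<noteq> 0"
proof
  assume eq: "of_real c * z + of_real d = 0"
  then have "Im (of_real c * z + of_real d) = 0" "Re (of_real c * z + of_real d) = 0"
    by simp_all
  then have "c = 0" "d = 0"
    using assms(2) by auto
  then show False
    using assms(1) by simp
qed

lemma Im_mobius:
  fixes a b c d :: real
  assumes "a * d - b * c = 1"
  shows "Im ((of_real a * z + of_real b) / (of_real c * z + of_real d)) =
    Im z / (cmod (of_real c * z + of_real d))\<^sup>2"
proof -
  have "(a * Im z) * (c * Re z + d) - (a * Re z + b) * (c * Im z) = (a * d - b * c) * Im z"
    by algebra
  then show ?thesis
    by (simp add: Im_divide cmod_power2 assms)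
qed

lemma to_complex_mobius:
  assumes "a * d - b * c = 1"
  shows "to_complex (mobius a b c d p) =
    (of_real a * to_complex p + of_real b) / (of_real c * to_complex p + of_real d)"
  unfolding mobius_def
proof (rule of_complex_inverse, rule CollectI)
  show "0 < Im ((of_real a * to_complex p + of_real b) / (of_real c * to_complex p + of_real d))"
    unfolding Im_mobius[OF assms]
    using mobius_denominator_nonzero[OF assms Im_to_complex[of p]] Im_to_complex[of p] by simp
qed

lemma mobius_det_mult:
  fixes a b c d a' b' c' d' :: real
  assumes "a * d - b * c = 1" "a' * d' - b' * c' = 1"
  shows "(a * a' + b * c') * (c * b' + d * d') - (a * b' + b * d') * (c * a' + d * c') = 1"
proof -
  have "(a * a' + b * c') * (c * b' + d * d') - (a * b' + b * d') * (c * a' + d * c') =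
      (a * d - b * c) * (a' * d' - b' * c')"
    by algebra
  then show ?thesis
    using assms by simp
qed

text \<open>Clearing the inner denominator \<open>w\<close> turns composition into multiplication of
  matrices.\<close>

lemma mobius_mobius:
  assumes "a * d - b * c = 1" "a' * d' - b' * c' = 1"
  shows "mobius a b c d (mobius a' b' c' d' p) =
    mobius (a * a' + b * c') (a * b' + b * d') (c * a' + d * c') (c * b' + d * d') p"
proof -
  let ?z = "to_complex p"
  have nz: "of_real c' * ?z + of_real d' \<noteq> 0"
    using mobius_denominator_nonzero[OF assms(2) Im_to_complex] .
  define u where "u = of_real a' * ?z + of_real b'"
  define w where "w = of_real c' * ?z + of_real d'"
  have w: "w \<noteq> 0"
    using nz by (simp add: w_def)
  then have "(of_real a * (u / w) + of_real b) / (of_real c * (u / w) + of_real d) =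
      (w * (of_real a * (u / w) + of_real b)) / (w * (of_real c * (u / w) + of_real d))"
    by simp
  also have "\<dots> = (of_real a * u + of_real b * w) / (of_real c * u + of_real d * w)"
    using w by (simp add: distrib_left mult.left_commute mult.commute)
  also have "\<dots> = (of_real (a * a' + b * c') * ?z + of_real (a * b' + b * d')) /
      (of_real (c * a' + d * c') * ?z + of_real (c * b' + d * d'))"
    by (simp add: u_def w_def algebra_simps)
  finally show ?thesis
    by (simp add: mobius_def[of a] mobius_def[of "a * a' + b * c'"] to_complex_mobius[OF assms(2)] u_def w_def)
qed

lemma mobius_id: "mobius 1 0 0 1 p = p" "mobius (-1) 0 0 (-1) p = p"
  by (simp_all add: mobius_def to_complex_inverse)

text \<open>With denominators \<open>Z\<close> and \<open>W\<close>, differences of values are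
  divided by \<open>Z * W\<close> and imaginary parts by the squared moduli of \<open>Z\<close> and
  \<open>W\<close>, so these factors cancel in \<open>cosh_dist\<close>.\<close>

lemma cosh_dist_mobius:
  assumes "a * d - b * c = 1"
  shows "cosh_dist (mobius a b c d p) (mobius a b c d q) = cosh_dist p q"
proof -
  let ?z = "to_complex p" and ?w = "to_complex q"
  define Z where "Z = of_real c * ?z + of_real d"
  define W where "W = of_real c * ?w + of_real d"
  have nz: "Z \<noteq> 0" "W \<noteq> 0"
    using mobius_denominator_nonzero[OF assms Im_to_complex] by (auto simp: Z_def W_def)
  have "(of_real a * ?z + of_real b) * W - (of_real a * ?w + of_real b) * Z =
      of_real (a * d - b * c) * (?z - ?w)"
    by (simp add: Z_def W_def algebra_simps)
  then have "(of_real a * ?z + of_real b) / Z - (of_real a * ?w + of_real b) / W = (?z - ?w) / (Z * W)"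
    using nz assms by (simp add: diff_frac_eq)
  moreover have "Im ((of_real a * ?z + of_real b) / Z) = Im ?z / (cmod Z)\<^sup>2"
    "Im ((of_real a * ?w + of_real b) / W) = Im ?w / (cmod W)\<^sup>2"
    unfolding Z_def W_def by (rule Im_mobius[OF assms])+
  ultimately show ?thesis
    using nz Im_to_complex[of p] Im_to_complex[of q]
    by (simp add: cosh_dist_def to_complex_mobius[OF assms] flip: Z_def W_def)
      (simp add: norm_divide norm_mult power_divide power_mult_distrib field_simps)
qed

lemma bij_mobius:
  assumes "a * d - b * c = 1"
  shows "bij (mobius a b c d)"
proof (rule bij_betw_byWitness[where f' = "mobius d (- b) (- c) a"])
  have inv: "d * a - (- b) * (- c) = 1"
    using assms by (simp add: algebra_simps)
  have one: "d * a - b * c = 1" "a * d - c * b = 1" "d * a - c * b = 1"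
    using assms by (simp_all add: algebra_simps)
  show "\<forall>p\<in>UNIV. mobius d (- b) (- c) a (mobius a b c d p) = p"
    using assms one by (simp add: mobius_mobius[OF inv assms] mobius_id mult.commute)
  show "\<forall>p\<in>UNIV. mobius a b c d (mobius d (- b) (- c) a p) = p"
    using assms one by (simp add: mobius_mobius[OF assms inv] mobius_id mult.commute)
qed auto

lemma isometry_mobius:
  assumes "a * d - b * c = 1"
  shows "isometry (mobius a b c d)"
  by (simp add: isometry_def bij_mobius[OF assms] dist_hyp_plane_def cosh_dist_mobius[OF assms])

lemma eventually_at_to_complex_Im_pos:
  "eventually (\<lambda>z. Im z > 0) (at (to_complex p))"
  using eventually_at_in_open'[of "{z. Im z > 0}" "to_complex p"] Im_to_complex[of p]
  by (simp add: open_halfspace_Im_gt)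

text \<open>The map is holomorphic with derivative 1 / (c z + d)^2, so its Jacobian determinant is
  the squared modulus of this nonzero number.\<close>

lemma orientation_preserving_mobius:
  assumes "a * d - b * c = 1"
  shows "orientation_preserving (mobius a b c d)"
  unfolding orientation_preserving_def
proof
  fix p
  let ?z = "to_complex p"
  let ?f = "\<lambda>z. (of_real a * z + of_real b) / (of_real c * z + of_real d)"
  let ?m = "1 / (of_real c * ?z + of_real d)\<^sup>2"
  have nz: "of_real c * ?z + of_real d \<noteq> 0"
    using mobius_denominator_nonzero[OF assms Im_to_complex] .
  have "(?f has_field_derivative (of_real a * (of_real c * ?z + of_real d) -
      (of_real a * ?z + of_real b) * of_real c) / ((of_real c * ?z + of_real d) * (of_real c * ?z + of_real d))) (at ?z)"
    by (rule derivative_eq_intros refl nz | simp)+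
  moreover have "of_real a * (of_real c * ?z + of_real d) - (of_real a * ?z + of_real b) * of_real c
      = (of_real (a * d - b * c) :: complex)"
    by (simp add: algebra_simps)
  ultimately have "(?f has_field_derivative ?m) (at ?z)"
    using assms by (simp add: power2_eq_square)
  then have "(?f has_derivative (*) ?m) (at ?z)"
    by (simp add: has_field_derivative_def)
  \<comment> \<open>The two functions are compared only on the half-plane, which is a neighbourhood
    of the point.\<close>
  moreover have "eventually (\<lambda>z. ?f z = to_complex (mobius a b c d (of_complex z))) (at ?z)"
    using eventually_at_to_complex_Im_pos[of p]
    by eventually_elim (simp add: to_complex_mobius[OF assms] of_complex_inverse)
  ultimately have "((\<lambda>z. to_complex (mobius a b c d (of_complex z))) has_derivative (*) ?m) (at ?z)"
    by (rule has_derivative_transform_eventually)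
      (simp_all add: to_complex_mobius[OF assms] to_complex_inverse)
  moreover have "Im (cnj (?m * 1) * (?m * \<i>)) > 0"
  proof -
    have "cnj (?m * 1) * (?m * \<i>) = of_real ((cmod ?m)\<^sup>2) * \<i>"
      using complex_norm_square[of ?m] by (simp add: mult_ac)
    then show ?thesis
      using nz by simp
  qed
  ultimately show "\<exists>D. ((\<lambda>z. to_complex (mobius a b c d (of_complex z))) has_derivative D) (at ?z) \<and>
      Im (cnj (D 1) * D \<i>) > 0"
    by blast
qed

text \<open>Fixed points are the roots of c z^2 + (d - a) z - b, whose discriminant (a + d)^2 - 4 is
  negative here; one of the two conjugate roots lies in the half-plane.\<close>

lemma mobius_elliptic_fixed_point:
  assumes det: "a * d - b * c = 1" and tr: "\<bar>a + d\<bar> < 2"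
  obtains p where "mobius a b c d p = p"
proof -
  have t: "(a + d)\<^sup>2 < 4"
    using tr abs_square_less_1[of "(a + d) / 2"] by (simp add: power_divide)
  \<comment> \<open>A triangular matrix of determinant one has trace of modulus at least 2.\<close>
  have c: "c \<noteq> 0"
  proof
    assume "c = 0"
    then have "(a + d)\<^sup>2 = 4 + (a - d)\<^sup>2"
      using det by (simp add: power2_eq_square algebra_simps)
    then show False
      using t by simp
  qed
  \<comment> \<open>The quadratic formula; \<open>\<bar>c\<bar>\<close> selects the root with
    positive imaginary part.\<close>
  define y where "y = sqrt (4 - (a + d)\<^sup>2) / (2 * \<bar>c\<bar>)"
  define x where "x = (a - d) / (2 * c)"
  define p where "p = of_complex (Complex x y)"
  have y: "y > 0"
    using t c by (simp add: y_def)
  have p: "to_complex p = Complex x y"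
    unfolding p_def using y by (intro of_complex_inverse) simp
  have cy: "(2 * c * y)\<^sup>2 = 4 - (a + d)\<^sup>2"
    using c t by (simp add: y_def power_mult_distrib power_divide)
  have cx: "2 * c * x = a - d"
    using c by (simp add: x_def)
  have nz: "of_real c * Complex x y + of_real d \<noteq> 0"
    using mobius_denominator_nonzero[OF det Im_to_complex[of p]] by (simp add: p)
  \<comment> \<open>The real part of the fixed point equation, scaled so that \<open>x\<close> and
    \<open>y\<close> enter through \<open>cx\<close> and \<open>cy\<close>; the imaginary part
    follows separately.\<close>
  have "4 * c * (c * (x\<^sup>2 - y\<^sup>2) + (d - a) * x - b) = (2 * c * x)\<^sup>2 - (2 * c * y)\<^sup>2 + 2 * (d - a) * (2 * c * x) - 4 * b * c"
    by algebra
  also have "\<dots> = 4 * (a * d - b * c) - 4"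
    unfolding cx cy by algebra
  finally have "c * (x\<^sup>2 - y\<^sup>2) + (d - a) * x - b = 0"
    using c det by simp
  moreover have "c * (2 * x * y) + (d - a) * y = 0"
    using cx by algebra
  ultimately have "of_real a * Complex x y + of_real b = Complex x y * (of_real c * Complex x y + of_real d)"
    by (auto simp: complex_eq_iff power2_eq_square algebra_simps)
  then have "to_complex (mobius a b c d p) = to_complex p"
    using nz by (simp add: to_complex_mobius[OF det] p)
  then show ?thesis
    using that by (simp add: to_complex_inject)
qed

text \<open>A matrix that acts as the identity is scalar, and the lower left entry of the square is
  \<open>c * (a + d)\<close>.\<close>

lemma mobius_square_eq_id:
  assumes det: "a * d - b * c = 1" and id: "\<And>p. mobius a b c d (mobius a b c d p) = p"
  shows "a + d = 0 \<or> c = 0"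
proof -
  let ?a = "a * a + b * c" and ?b = "a * b + b * d" and ?c = "c * a + d * c" and ?d = "c * b + d * d"
  have fixed: "of_real ?a * z + of_real ?b = z * (of_real ?c * z + of_real ?d)" if "Im z > 0" for z :: complex
  proof -
    have z: "to_complex (of_complex z) = z"
      using that by (simp add: of_complex_inverse)
    have "to_complex (mobius ?a ?b ?c ?d (of_complex z)) = z"
      using id[of "of_complex z"] by (simp add: mobius_mobius[OF det det] z)
    moreover have "of_real ?c * z + of_real ?d \<noteq> 0"
      using mobius_denominator_nonzero[OF mobius_det_mult[OF det det] that] .
    ultimately show ?thesis
      unfolding to_complex_mobius[OF mobius_det_mult[OF det det]] z
      by (simp add: nonzero_divide_eq_eq)
  qed
  \<comment> \<open>Two points on the imaginary axis are enough to force the lower left entry to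
    vanish.\<close>
  have 1: "?a = ?d" "?b = - ?c"
    using fixed[of \<i>] by (auto simp: complex_eq_iff)
  have 2: "?b = - 4 * ?c"
    using fixed[of "2 * \<i>"] 1 by (auto simp: complex_eq_iff)
  from 1 2 have "?c = 0"
    by algebra
  then have "c * (a + d) = 0"
    by (simp add: algebra_simps)
  then show ?thesis
    by auto
qed

section \<open>Geodesic lines\<close>

lemma cosh_dist_geodesic_line:
  assumes "geodesic_line \<sigma>"
  shows "cosh_dist (\<sigma> s) (\<sigma> t) = cosh (s - t)"
proof -
  have "cosh (arcosh (cosh_dist (\<sigma> s) (\<sigma> t))) = cosh \<bar>s - t\<bar>"
    using assms by (simp add: geodesic_line_def dist_hyp_plane_def)
  then show ?thesis
    by (simp add: cosh_dist_ge_1)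
qed

text \<open>
  The unit vector \<open>(c, e)\<close> is the direction of \<open>\<sigma>\<close> at \<open>\<sigma> s\<close>: in the hyperboloid model, with
  coordinates \<open>(1 / y, x / y, (x\<^sup>2 + y\<^sup>2) / y)\<close>, a geodesic is \<open>cosh r P + sinh r V\<close>.
\<close>

definition geodesic_direction :: "(real \<Rightarrow> hyp_plane) \<Rightarrow> real \<Rightarrow> real \<Rightarrow> real \<Rightarrow> bool" where
  "geodesic_direction \<sigma> s c e \<longleftrightarrow> c\<^sup>2 + e\<^sup>2 = 1 \<and>
     (\<forall>r. to_complex (\<sigma> (s + r)) = Complex
        (Re (to_complex (\<sigma> s)) + Im (to_complex (\<sigma> s)) * c * sinh r / (cosh r - e * sinh r))
        (Im (to_complex (\<sigma> s)) / (cosh r - e * sinh r)))"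

text \<open>This is the denominator in \<open>geodesic_direction\<close>, which therefore makes
  sense for every \<open>r\<close>.\<close>

lemma cosh_minus_sinh_pos:
  fixes c e r :: real
  assumes "c\<^sup>2 + e\<^sup>2 = 1"
  shows "cosh r - e * sinh r > 0"
proof -
  have "\<bar>e\<bar> \<le> 1"
    using assms abs_square_le_1[of e] zero_le_power2[of c] by linarith
  then have "\<bar>e * sinh r\<bar> \<le> \<bar>sinh r\<bar>"
    by (simp add: abs_mult mult_left_le_one_le)
  moreover have "\<bar>sinh r\<bar> < cosh r"
    using cosh_plus_sinh[of r] cosh_minus_sinh[of r] exp_gt_zero[of r] exp_gt_zero[of "- r"]
    by linarith
  ultimately show ?thesis
    by linarith
qed

text \<open>The direction is read off from the point at time \<open>s + 1\<close>. Any further point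
  of the line is then determined by its distances from the points at times \<open>s\<close> and
  \<open>s + 1\<close>.\<close>

lemma geodesic_direction_exists:
  assumes "geodesic_line \<sigma>"
  obtains c e where "geodesic_direction \<sigma> s c e"
proof -
  define x y where "x = Re (to_complex (\<sigma> s))" and "y = Im (to_complex (\<sigma> s))"
  define x1 y1 where "x1 = Re (to_complex (\<sigma> (s + 1)))" and "y1 = Im (to_complex (\<sigma> (s + 1)))"
  define C1 S1 :: real where "C1 = cosh 1" and "S1 = sinh 1"
  have pos: "y > 0" "y1 > 0" "S1 > 0"
    by (simp_all add: y_def y1_def Im_to_complex S1_def)
  have CS1: "C1\<^sup>2 = 1 + S1\<^sup>2"
    by (simp add: C1_def S1_def cosh_square_eq)
  \<comment> \<open>These values solve the formula of \<open>geodesic_direction\<close> at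
    \<open>r = 1\<close>.\<close>
  define c where "c = (x1 - x) / (y1 * S1)"
  define e where "e = (C1 - y / y1) / S1"
  have c: "x1 - x = c * y1 * S1" and e: "y = y1 * (C1 - e * S1)"
    using pos by (simp_all add: c_def e_def field_simps)
  have d1: "C1 * (2 * y * y1) = (x - x1)\<^sup>2 + y\<^sup>2 + y1\<^sup>2"
    using cosh_dist_mult[of "\<sigma> s" "\<sigma> (s + 1)"]
    by (simp add: cosh_dist_geodesic_line[OF assms] C1_def x_def y_def x1_def y1_def)
  \<comment> \<open>That the points at times \<open>s\<close> and \<open>s + 1\<close> have distance
    1 is equivalent to \<open>(c, e)\<close> being a unit vector.\<close>
  have "(y1 * S1)\<^sup>2 * (c\<^sup>2 + e\<^sup>2) = (y1 * S1)\<^sup>2"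
    using c e d1 CS1 by algebra
  then have ce: "c\<^sup>2 + e\<^sup>2 = 1"
    using pos by simp
  have "to_complex (\<sigma> (s + r)) = Complex (x + y * c * sinh r / (cosh r - e * sinh r))
      (y / (cosh r - e * sinh r))" for r
  proof -
    define X Y where "X = Re (to_complex (\<sigma> (s + r)))" and "Y = Im (to_complex (\<sigma> (s + r)))"
    define C S where "C = cosh r" and "S = sinh r"
    have CS: "C\<^sup>2 = 1 + S\<^sup>2"
      by (simp add: C_def S_def cosh_square_eq)
    have K: "C - e * S > 0"
      using cosh_minus_sinh_pos[OF ce] by (simp add: C_def S_def)
    have d2: "C * (2 * y * Y) = (x - X)\<^sup>2 + y\<^sup>2 + Y\<^sup>2"
      using cosh_dist_mult[of "\<sigma> s" "\<sigma> (s + r)"]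
      by (simp add: cosh_dist_geodesic_line[OF assms] C_def x_def y_def X_def Y_def)
    have d3: "(C1 * C - S1 * S) * (2 * y1 * Y) = (x1 - X)\<^sup>2 + y1\<^sup>2 + Y\<^sup>2"
      using cosh_dist_mult[of "\<sigma> (s + 1)" "\<sigma> (s + r)"]
      by (simp add: cosh_dist_geodesic_line[OF assms] cosh_diff C_def S_def C1_def S1_def x1_def y1_def X_def Y_def)
    \<comment> \<open>Eliminating \<open>d2\<close> from \<open>d3\<close> amounts to computing the
      Lorentz product of the point at time \<open>s + r\<close> with the direction vector, which is
      linear in \<open>X\<close>.\<close>
    have "(2 * y1 * S1) * ((X - x) * c + Y * C * e - y * e) = (2 * y1 * S1) * (Y * S)"
      using c e d1 d2 d3 by algebra
    then have lin: "(X - x) * c + Y * C * e - y * e = Y * S"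
      using pos by simp
    \<comment> \<open>Two distances leave at most a mirror pair of candidates; for points of the
      line the pair collapses, visible as a vanishing sum of squares.\<close>
    have "(X - x - Y * c * S)\<^sup>2 + (Y * (C - e * S) - y)\<^sup>2 = 0"
      using lin d2 ce CS by algebra
    then have "X - x = Y * c * S" "Y * (C - e * S) = y"
      by (simp_all add: sum_power2_eq_zero_iff)
    then have "Y = y / (C - e * S)" "X = x + Y * c * S"
      using K by (auto simp: nonzero_eq_divide_eq)
    then have "Y = y / (C - e * S)" "X = x + y * c * S / (C - e * S)"
      by simp_all
    then show ?thesis
      by (simp add: complex_eq_iff X_def Y_def C_def S_def)
  qed
  then show ?thesis
    using ce by (intro that[of c e]) (simp add: geodesic_direction_def x_def y_def)
qed

text \<open>The direction at time \<open>a\<close> can be recovered from the point at time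
  \<open>b\<close>, because \<open>sinh (b - a)\<close> is nonzero, and the direction determines the
  whole line.\<close>

lemma geodesic_line_unique:
  assumes "geodesic_line \<sigma>" "geodesic_line \<tau>" "a \<noteq> b" "\<sigma> a = \<tau> a" "\<sigma> b = \<tau> b"
  shows "\<sigma> = \<tau>"
proof
  fix t
  obtain c e where ce: "geodesic_direction \<sigma> a c e"
    using geodesic_direction_exists[OF assms(1)] .
  obtain c' e' where ce': "geodesic_direction \<tau> a c' e'"
    using geodesic_direction_exists[OF assms(2)] .
  have y: "Im (to_complex (\<tau> a)) > 0"
    by (rule Im_to_complex)
  have K: "cosh (b - a) - e * sinh (b - a) > 0" "cosh (b - a) - e' * sinh (b - a) > 0"
    using ce ce' unfolding geodesic_direction_def by (blast intro: cosh_minus_sinh_pos)+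
  have b: "to_complex (\<sigma> (a + (b - a))) = to_complex (\<tau> (a + (b - a)))"
    using assms(5) by simp
  have "Im (to_complex (\<tau> a)) / (cosh (b - a) - e * sinh (b - a)) =
      Im (to_complex (\<tau> a)) / (cosh (b - a) - e' * sinh (b - a))"
    using b ce ce' unfolding geodesic_direction_def assms(4) by (metis complex.sel(2))
  then have e: "e = e'"
    using K y assms(3) by (simp add: field_simps)
  have "Im (to_complex (\<tau> a)) * c * sinh (b - a) / (cosh (b - a) - e' * sinh (b - a)) =
      Im (to_complex (\<tau> a)) * c' * sinh (b - a) / (cosh (b - a) - e' * sinh (b - a))"
    using b ce ce' unfolding geodesic_direction_def assms(4) e by (metis complex.sel(1) add_left_imp_eq)
  then have c: "c = c'"
    using K(2) y assms(3) by simp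
  have "to_complex (\<sigma> (a + (t - a))) = to_complex (\<tau> (a + (t - a)))"
    using ce ce' unfolding geodesic_direction_def assms(4) e c by presburger
  then show "\<sigma> t = \<tau> t"
    by (simp add: to_complex_inject)
qed

lemma geodesic_direction_has_vector_derivative:
  assumes "geodesic_direction \<sigma> s c e"
  shows "((\<lambda>t. to_complex (\<sigma> t)) has_vector_derivative Im (to_complex (\<sigma> s)) *\<^sub>R Complex c e) (at s)"
proof -
  define x y where "x = Re (to_complex (\<sigma> s))" and "y = Im (to_complex (\<sigma> s))"
  let ?K = "\<lambda>t. cosh (t - s) - e * sinh (t - s)"
  have \<sigma>: "to_complex (\<sigma> t) = Complex (x + y * c * sinh (t - s) / ?K t) (y / ?K t)" for t
    using assms unfolding geodesic_direction_def x_def y_def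
    by (metis add_diff_cancel_left' diff_add_cancel add.commute)
  have 1: "((\<lambda>t. x + y * c * sinh (t - s) / ?K t) has_real_derivative y * c) (at s)"
    by (auto intro!: derivative_eq_intros)
  have 2: "((\<lambda>t. y / ?K t) has_real_derivative y * e) (at s)"
    by (auto intro!: derivative_eq_intros)
  have "((\<lambda>t. Complex (x + y * c * sinh (t - s) / ?K t) (y / ?K t))
      has_vector_derivative Complex (y * c) (y * e)) (at s)"
    unfolding has_vector_derivative_complex_iff complex.sel using 1 2 by blast
  then show ?thesis
    unfolding y_def[symmetric] \<sigma> by (simp add: scaleR_complex.ctr)
qed

lemma geodesic_direction_velocity:
  "geodesic_direction \<sigma> s c e \<Longrightarrow> velocity \<sigma> s = Im (to_complex (\<sigma> s)) *\<^sub>R Complex c e"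
  unfolding velocity_def
  by (rule vector_derivative_at) (rule geodesic_direction_has_vector_derivative)

section \<open>Half turns\<close>

text \<open>The rotation by pi about \<open>q\<close>: its matrix fixes \<open>q\<close>, has trace
  0 and determinant 1, and squares to minus the identity. Its entries are linear in the hyperboloid
  coordinates of \<open>q\<close>.\<close>

definition half_turn :: "hyp_plane \<Rightarrow> hyp_plane \<Rightarrow> hyp_plane" where
  "half_turn q =
     (let x = Re (to_complex q); y = Im (to_complex q)
      in mobius (x / y) (- (x\<^sup>2 + y\<^sup>2) / y) (1 / y) (- x / y))"

lemma half_turn_det:
  fixes x y :: real
  assumes "y \<noteq> 0"
  shows "(x / y) * (- x / y) - (- (x\<^sup>2 + y\<^sup>2) / y) * (1 / y) = 1"
  using assms by (simp add: field_simps power2_eq_square)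

lemma half_turn_half_turn: "half_turn q (half_turn q p) = p"
proof -
  define x y where "x = Re (to_complex q)" and "y = Im (to_complex q)"
  have y: "y \<noteq> 0"
    using Im_to_complex[of q] by (simp add: y_def)
  have "(x / y) * (x / y) + (- (x\<^sup>2 + y\<^sup>2) / y) * (1 / y) = - 1"
    "(x / y) * (- (x\<^sup>2 + y\<^sup>2) / y) + (- (x\<^sup>2 + y\<^sup>2) / y) * (- x / y) = 0"
    "(1 / y) * (x / y) + (- x / y) * (1 / y) = 0"
    "(1 / y) * (- (x\<^sup>2 + y\<^sup>2) / y) + (- x / y) * (- x / y) = - 1"
    using y by (simp_all add: field_simps power2_eq_square)
  then show ?thesis
    unfolding half_turn_def Let_def x_def[symmetric] y_def[symmetric]
    by (simp only: mobius_mobius[OF half_turn_det half_turn_det, OF y y] mobius_id)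
qed

text \<open>Up to translation by \<open>x\<close> and scaling by \<open>y\<close>, the half turn is
  z -> -1/z, so it sends x + y u / K to x - y K / u. The squared modulus of \<open>u\<close> is
  \<open>K * L\<close>, where \<open>L\<close> is the denominator at \<open>- r\<close>, and this
  identifies the image.\<close>

lemma half_turn_geodesic_line:
  assumes "geodesic_line \<sigma>"
  shows "half_turn (\<sigma> s) (\<sigma> (s + r)) = \<sigma> (s - r)"
proof -
  obtain c e where ce: "geodesic_direction \<sigma> s c e"
    using geodesic_direction_exists[OF assms] .
  define x y where "x = Re (to_complex (\<sigma> s))" and "y = Im (to_complex (\<sigma> s))"
  have y: "y > 0"
    by (simp add: y_def Im_to_complex)
  have 1: "c\<^sup>2 + e\<^sup>2 = 1"
    using ce by (simp add: geodesic_direction_def)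
  define C S where "C = cosh r" and "S = sinh r"
  define K L where "K = C - e * S" and "L = C + e * S"
  have K: "K > 0" and L: "L > 0"
    using cosh_minus_sinh_pos[OF 1, of r] cosh_minus_sinh_pos[OF 1, of "- r"]
    by (simp_all add: K_def L_def C_def S_def)
  have KL: "K * L = 1 + c\<^sup>2 * S\<^sup>2"
  proof -
    have "C\<^sup>2 = 1 + S\<^sup>2"
      by (simp add: C_def S_def cosh_square_eq)
    then show ?thesis
      using 1 unfolding K_def L_def by algebra
  qed
  have ce': "to_complex (\<sigma> (s + r)) = Complex (x + y * c * sinh r / (cosh r - e * sinh r))
      (y / (cosh r - e * sinh r))" for r
    using ce unfolding geodesic_direction_def x_def y_def by blast
  have z: "to_complex (\<sigma> (s + r)) = of_real x + of_real y * Complex (c * S) 1 / of_real K"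
    unfolding ce' by (simp add: complex_eq_iff K_def C_def S_def)
  have w: "to_complex (\<sigma> (s + (- r))) = of_real x + of_real y * Complex (- c * S) 1 / of_real L"
    unfolding ce' by (simp add: complex_eq_iff L_def C_def S_def)
  define u where "u = Complex (c * S) 1"
  have u: "u \<noteq> 0"
    by (simp add: u_def complex_eq_iff)
  have uu: "Complex (- c * S) 1 * u = - of_real (K * L)"
    unfolding KL u_def by (simp add: complex_eq_iff power2_eq_square)
  have "to_complex (half_turn (\<sigma> s) (\<sigma> (s + r))) =
      (of_real (x / y) * to_complex (\<sigma> (s + r)) + of_real (- (x\<^sup>2 + y\<^sup>2) / y)) /
      (of_real (1 / y) * to_complex (\<sigma> (s + r)) + of_real (- x / y))"
    unfolding half_turn_def Let_def x_def[symmetric] y_def[symmetric]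
    using y by (intro to_complex_mobius half_turn_det) simp
  also have "\<dots> = (of_real x * u / of_real K - of_real y) / (u / of_real K)"
  proof (rule arg_cong2[where f = "(/)"])
    show "of_real (x / y) * to_complex (\<sigma> (s + r)) + of_real (- (x\<^sup>2 + y\<^sup>2) / y) = of_real x * u / of_real K - of_real y"
      unfolding z u_def[symmetric] using y K by (simp add: field_simps power2_eq_square)
    show "of_real (1 / y) * to_complex (\<sigma> (s + r)) + of_real (- x / y) = u / of_real K"
      unfolding z u_def[symmetric] using y K by (simp add: field_simps)
  qed
  also have "\<dots> = of_real x - of_real y * of_real K / u"
    using u K by (simp add: field_simps)
  also have "\<dots> = of_real x + of_real y * Complex (- c * S) 1 / of_real L"
  proof -
    have K': "of_real K = - (Complex (- c * S) 1 * u) / of_real L"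
      unfolding uu using L by simp
    have "of_real y * of_real K / u = - (of_real y * Complex (- c * S) 1 / of_real L)"
      unfolding K' using u by simp
    then show ?thesis
      by simp
  qed
  finally show ?thesis
    using w by (simp flip: to_complex_inject)
qed

lemma mobius_half_turn:
  "\<exists>a b c d. a * d - b * c = 1 \<and> half_turn q = mobius a b c d"
proof -
  have "Im (to_complex q) \<noteq> 0"
    using Im_to_complex[of q] by simp
  from half_turn_det[OF this] show ?thesis
    unfolding half_turn_def Let_def by blast
qed

section \<open>Orientation preserving isometries\<close>

text \<open>The differentiated function is \<open>cosh_dist\<close> from the point with coordinates
  \<open>x\<close> and \<open>y\<close>, in the form given by \<open>cosh_dist_mult\<close>.\<close>

lemma has_derivative_cosh_dist:
  fixes x y :: real
  assumes "y > 0" "Im w > 0"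
  shows "((\<lambda>w. ((x - Re w)\<^sup>2 + y\<^sup>2 + (Im w)\<^sup>2) / (2 * y * Im w)) has_derivative
    (\<lambda>v. Re v * ((Re w - x) / (y * Im w)) +
         Im v * (((Im w)\<^sup>2 - (x - Re w)\<^sup>2 - y\<^sup>2) / (2 * y * (Im w)\<^sup>2)))) (at w)"
proof -
  let ?N = "\<lambda>w. (x - Re w)\<^sup>2 + y\<^sup>2 + (Im w)\<^sup>2"
  have N: "(?N has_derivative (\<lambda>v. 2 * (x - Re w) * (- Re v) + 2 * Im w * Im v)) (at w)"
    by (auto intro!: derivative_eq_intros)
  have D: "((\<lambda>w. 2 * y * Im w) has_derivative (\<lambda>v. 2 * y * Im v)) (at w)"
    by (auto intro!: derivative_eq_intros)
  have "((\<lambda>w. ?N w / (2 * y * Im w)) has_derivative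
      (\<lambda>v. ((2 * (x - Re w) * (- Re v) + 2 * Im w * Im v) * (2 * y * Im w) - ?N w * (2 * y * Im v)) /
        ((2 * y * Im w) * (2 * y * Im w)))) (at w)"
    by (rule has_derivative_divide'[OF N D]) (use assms in simp)
  moreover have "((2 * (x - Re w) * (- Re v) + 2 * Im w * Im v) * (2 * y * Im w) - ?N w * (2 * y * Im v)) /
      ((2 * y * Im w) * (2 * y * Im w)) = Re v * ((Re w - x) / (y * Im w)) +
         Im v * (((Im w)\<^sup>2 - (x - Re w)\<^sup>2 - y\<^sup>2) / (2 * y * (Im w)\<^sup>2))" for v
    using assms by (simp add: divide_simps) algebra
  ultimately show ?thesis
    by simp
qed

lemma isometry_cosh_dist:
  "isometry f \<Longrightarrow> cosh_dist (f p) (f q) = cosh_dist p q"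
  by (metis cosh_arcosh_real cosh_dist_ge_1 isometry_def dist_hyp_plane_def)

text \<open>Invariance of \<open>cosh_dist\<close> expresses the squared difference quotient in
  direction \<open>v\<close> through imaginary parts only; then \<open>h\<close> tends to 0.\<close>

lemma isometry_derivative_norm:
  assumes f: "isometry f"
    and D: "((\<lambda>z. to_complex (f (of_complex z))) has_derivative D) (at (to_complex p))"
  shows "cmod (D v) = Im (to_complex (f p)) / Im (to_complex p) * cmod v"
proof (cases "v = 0")
  case True
  then show ?thesis
    using has_derivative_bounded_linear[OF D] by (simp add: linear_simps)
next
  case v: False
  let ?z = "to_complex p"
  let ?F = "\<lambda>z. to_complex (f (of_complex z))"
  let ?l = "\<lambda>h::real. ?z + of_real h * v"
  have y: "Im ?z > 0" "Im (?F ?z) > 0"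
    by (rule Im_to_complex)+
  have l: "(?l has_derivative (\<lambda>h. of_real h * v)) (at 0)"
    by (auto intro!: derivative_eq_intros)
  have F: "((\<lambda>h. ?F (?l h)) has_derivative (\<lambda>h. D (of_real h * v))) (at 0)"
    using has_derivative_compose[OF l, of ?F D] D by simp
  have Dh: "D (of_real h * v) = of_real h * D v" for h
    using has_derivative_bounded_linear[OF D]
    by (simp add: linear_simps(5) flip: scaleR_conv_of_real)
  \<comment> \<open>Frechet differentiability is turned into convergence of the difference quotient
    along \<open>v\<close>.\<close>
  have "((\<lambda>h. (1 / h) *\<^sub>R (?F (?l h) - ?F ?z) - D v) \<longlongrightarrow> 0) (at 0)"
  proof (rule tendsto_norm_zero_cancel, rule Lim_transform_eventually)
    show "((\<lambda>h. cmod (?F (?l h) - ?F (?l 0) - D (of_real (h - 0) * v)) / norm (h - 0)) \<longlongrightarrow> 0) (at 0)"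
      using F unfolding has_derivative_iff_norm by blast
    show "\<forall>\<^sub>F h in at 0. cmod (?F (?l h) - ?F (?l 0) - D (of_real (h - 0) * v)) / norm (h - 0) =
        cmod ((1 / h) *\<^sub>R (?F (?l h) - ?F ?z) - D v)"
      using eventually_neq_at_within[of 0 0 UNIV]
    proof eventually_elim
      case (elim h)
      have "(1 / h) *\<^sub>R (?F (?l h) - ?F ?z) - D v = (1 / h) *\<^sub>R (?F (?l h) - ?F (?l 0) - D (of_real (h - 0) * v))"
        unfolding Dh using elim by (simp add: scaleR_diff_right flip: scaleR_conv_of_real)
      then show ?case
        by (simp only: norm_scaleR) simp
    qed
  qed
  from LIM_zero_cancel[OF this]
  have "((\<lambda>h. (1 / h) *\<^sub>R (?F (?l h) - ?F ?z)) \<longlongrightarrow> D v) (at 0)" .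
  then have lim: "((\<lambda>h. (cmod ((1 / h) *\<^sub>R (?F (?l h) - ?F ?z)))\<^sup>2) \<longlongrightarrow> (cmod (D v))\<^sup>2) (at 0)"
    by (intro tendsto_intros)
  have cont: "((\<lambda>h. ?F (?l h)) \<longlongrightarrow> ?F ?z) (at 0)"
    using has_derivative_continuous[OF F] by (simp add: continuous_within)
  have "((\<lambda>h. (cmod v)\<^sup>2 * (Im (?F (?l h)) * Im (?F ?z)) / (Im (?l h) * Im ?z)) \<longlongrightarrow>
      (cmod v)\<^sup>2 * (Im (?F ?z) * Im (?F ?z)) / (Im (?z + of_real 0 * v) * Im ?z)) (at 0)"
    using y by (intro tendsto_intros cont) auto
  moreover have "eventually (\<lambda>h. (cmod v)\<^sup>2 * (Im (?F (?l h)) * Im (?F ?z)) / (Im (?l h) * Im ?z) =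
      (cmod ((1 / h) *\<^sub>R (?F (?l h) - ?F ?z)))\<^sup>2) (at 0)"
  proof -
    have "(?l \<longlongrightarrow> ?z + of_real 0 * v) (at 0)"
      by (intro tendsto_intros)
    then have "eventually (\<lambda>h. Im (?l h) > 0) (at 0)"
      using y topological_tendstoD[of ?l ?z "at 0" "{z. Im z > 0}"] by (simp add: open_halfspace_Im_gt)
    then show ?thesis
      using eventually_neq_at_within[of 0 0 UNIV]
    proof eventually_elim
      case (elim h)
      have cross_mult: "A = N * (a * b / (c * d))"
        if "A / (2 * a * b) = N / (2 * c * d)" "a > 0" "b > 0" "c > 0" "d > 0" for A N a b c d :: real
        using that by (simp add: field_simps)
      have Fh: "Im (?F (?l h)) > 0"
        by (rule Im_to_complex)
      have "cosh_dist (f (of_complex (?l h))) (f p) = cosh_dist (of_complex (?l h)) p"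
        by (rule isometry_cosh_dist[OF f])
      then have dist: "(cmod (?F (?l h) - ?F ?z))\<^sup>2 / (2 * Im (?F (?l h)) * Im (?F ?z)) =
          (cmod (of_real h * v))\<^sup>2 / (2 * Im (?l h) * Im ?z)"
        using elim by (simp add: cosh_dist_def of_complex_inverse to_complex_inverse)
      have "(cmod (?F (?l h) - ?F ?z))\<^sup>2 = h\<^sup>2 * ((cmod v)\<^sup>2 * (Im (?F (?l h)) * Im (?F ?z)) / (Im (?l h) * Im ?z))"
        using cross_mult[OF dist Fh y(2) elim(1) y(1)] by (simp add: norm_mult power_mult_distrib)
      then show ?case
        using elim by (simp add: power_mult_distrib power_divide)
    qed
  qed
  ultimately have "((\<lambda>h. (cmod ((1 / h) *\<^sub>R (?F (?l h) - ?F ?z)))\<^sup>2) \<longlongrightarrow>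
      (cmod v)\<^sup>2 * (Im (?F ?z) * Im (?F ?z)) / (Im (?z + of_real 0 * v) * Im ?z)) (at 0)"
    by (rule Lim_transform_eventually)
  from tendsto_unique[OF _ lim this]
  have "(cmod (D v))\<^sup>2 = (Im (?F ?z) / Im ?z * cmod v)\<^sup>2"
    by (simp add: power2_eq_square)
  then show ?thesis
    using y by (simp add: to_complex_inverse)
qed

text \<open>Scaling all lengths by \<open>k\<close> makes the images of 1 and i orthogonal and
  equally long, and the positive determinant excludes a reflection.\<close>

lemma conformal_linear_eq_mult:
  assumes "bounded_linear D" "\<And>v. cmod (D v) = k * cmod v" "Im (cnj (D 1) * D \<i>) > 0"
  shows "D v = D 1 * v"
proof -
  obtain a b where D1: "D 1 = Complex a b" by (cases "D 1")
  obtain c d where Di: "D \<i> = Complex c d" by (cases "D \<i>")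
  have "D (1 + \<i>) = D 1 + D \<i>"
    using assms(1) by (simp add: linear_simps)
  then have "(cmod (D 1 + D \<i>))\<^sup>2 = k\<^sup>2 * (cmod (1 + \<i>))\<^sup>2"
    by (metis assms(2) power_mult_distrib)
  then have 1: "(a + c)\<^sup>2 + (b + d)\<^sup>2 = k\<^sup>2 * 2"
    by (simp add: D1 Di cmod_power2)
  have "(cmod (D 1))\<^sup>2 = k\<^sup>2" "(cmod (D \<i>))\<^sup>2 = k\<^sup>2"
    by (simp_all add: assms(2))
  then have 2: "a\<^sup>2 + b\<^sup>2 = k\<^sup>2" "c\<^sup>2 + d\<^sup>2 = k\<^sup>2"
    by (simp_all add: D1 Di cmod_power2)
  have pos: "a * d - b * c > 0"
    using assms(3) by (simp add: D1 Di algebra_simps)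
  have orth: "a * c + b * d = 0"
    using 1 2 by (simp add: power2_eq_square algebra_simps)
  \<comment> \<open>The Lagrange identity: squared determinant plus squared inner product is the
    product of the squared lengths.\<close>
  have "(a * d - b * c) * (a * d - b * c) = k\<^sup>2 * k\<^sup>2"
    using 2 orth by algebra
  then have det: "a * d - b * c = k\<^sup>2"
    using pos by (metis abs_of_pos abs_mult_self_eq abs_power2 power2_eq_iff_nonneg power2_eq_square zero_le_power2 less_imp_le)
  have "(c + b)\<^sup>2 + (d - a)\<^sup>2 = 0"
    using det 2 by (simp add: power2_eq_square algebra_simps)
  then have "c = - b" "d = a"
    by (auto simp: sum_power2_eq_zero_iff)
  then have Di': "D \<i> = D 1 * \<i>"
    by (simp add: D1 Di complex_eq_iff)
  have "v = Re v *\<^sub>R 1 + Im v *\<^sub>R \<i>"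
    by (simp add: complex_eq_iff)
  then have "D v = Re v *\<^sub>R D 1 + Im v *\<^sub>R D \<i>"
    using assms(1) by (metis linear_simps(1) linear_simps(5))
  also have "\<dots> = D 1 * v"
    unfolding Di' by (simp add: complex_eq_iff algebra_simps)
  finally show ?thesis .
qed

text \<open>The value plus \<open>w\<close> times the vertical derivative equals
  \<open>w / y\<close>, which gives the height of \<open>p\<close>; the horizontal derivative then
  gives its real part.\<close>

lemma cosh_dist_gradient_inject:
  fixes p p' q :: hyp_plane
  defines "x \<equiv> Re (to_complex p)" and "y \<equiv> Im (to_complex p)"
    and "x' \<equiv> Re (to_complex p')" and "y' \<equiv> Im (to_complex p')"
    and "u \<equiv> Re (to_complex q)" and "w \<equiv> Im (to_complex q)"
  assumes "cosh_dist p q = cosh_dist p' q"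
    and "(u - x) / (y * w) = (u - x') / (y' * w)"
    and "(w\<^sup>2 - (x - u)\<^sup>2 - y\<^sup>2) / (2 * y * w\<^sup>2) = (w\<^sup>2 - (x' - u)\<^sup>2 - y'\<^sup>2) / (2 * y' * w\<^sup>2)"
  shows "p = p'"
proof -
  have pos: "y > 0" "y' > 0" "w > 0"
    by (simp_all add: y_def y'_def w_def Im_to_complex)
  have C: "cosh_dist p q = ((x - u)\<^sup>2 + y\<^sup>2 + w\<^sup>2) / (2 * y * w)"
    "cosh_dist p' q = ((x' - u)\<^sup>2 + y'\<^sup>2 + w\<^sup>2) / (2 * y' * w)"
    using pos cosh_dist_mult[of p q] cosh_dist_mult[of p' q]
    by (simp_all add: x_def y_def x'_def y'_def u_def w_def field_simps)
  have "w / y = cosh_dist p q + w * ((w\<^sup>2 - (x - u)\<^sup>2 - y\<^sup>2) / (2 * y * w\<^sup>2))"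
    unfolding C using pos by (simp add: field_simps power2_eq_square)
  also have "\<dots> = cosh_dist p' q + w * ((w\<^sup>2 - (x' - u)\<^sup>2 - y'\<^sup>2) / (2 * y' * w\<^sup>2))"
    using assms(7-9) by simp
  also have "\<dots> = w / y'"
    unfolding C using pos by (simp add: field_simps power2_eq_square)
  finally have y: "y = y'"
    using pos by (simp add: field_simps)
  then have "x = x'"
    using assms(8) pos by simp
  then show ?thesis
    using y by (simp add: x_def x'_def y_def y'_def complex_eq_iff flip: to_complex_inject)
qed

text \<open>
  The derivatives of \<open>f\<close> and \<open>g\<close> at a point of \<open>\<sigma>\<close> are conformal and agree on the tangent of \<open>\<sigma>\<close>,
  so they are equal. An isometry is then determined everywhere by the gradients of the
  distance functions from the images of the points.
\<close>

lemma orientation_preserving_isometry_eqI: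
  assumes f: "isometry f" "orientation_preserving f"
    and g: "isometry g" "orientation_preserving g"
    and \<sigma>: "geodesic_line \<sigma>" "\<And>t. f (\<sigma> t) = g (\<sigma> t)"
  shows "f = g"
proof
  fix a
  define p where "p = \<sigma> 0"
  let ?z = "to_complex p"
  let ?F = "\<lambda>z. to_complex (f (of_complex z))"
  let ?G = "\<lambda>z. to_complex (g (of_complex z))"
  have fg: "f p = g p"
    by (simp add: p_def \<sigma>)
  obtain D where D: "(?F has_derivative D) (at ?z)" "Im (cnj (D 1) * D \<i>) > 0"
    using f(2) unfolding orientation_preserving_def by blast
  obtain E where E: "(?G has_derivative E) (at ?z)" "Im (cnj (E 1) * E \<i>) > 0"
    using g(2) unfolding orientation_preserving_def by blast
  have D': "D v = D 1 * v" for v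
    by (rule conformal_linear_eq_mult[OF has_derivative_bounded_linear[OF D(1)]
          isometry_derivative_norm[OF f(1) D(1)] D(2)])
  have E': "E v = E 1 * v" for v
    by (rule conformal_linear_eq_mult[OF has_derivative_bounded_linear[OF E(1)]
          isometry_derivative_norm[OF g(1) E(1)] E(2)])
  obtain c e where ce: "geodesic_direction \<sigma> 0 c e"
    using geodesic_direction_exists[OF \<sigma>(1)] .
  define V where "V = Im ?z *\<^sub>R Complex c e"
  have V: "V \<noteq> 0"
    using ce Im_to_complex[of p] by (auto simp: V_def geodesic_direction_def complex_eq_iff)
  have "((\<lambda>t. to_complex (\<sigma> t)) has_vector_derivative V) (at 0)"
    using geodesic_direction_has_vector_derivative[OF ce] by (simp add: V_def p_def)
  then have *: "((\<lambda>t. to_complex (\<sigma> t)) has_derivative (\<lambda>h. h *\<^sub>R V)) (at 0)"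
    by (simp add: has_vector_derivative_def)
  have "((\<lambda>t. ?F (to_complex (\<sigma> t))) has_derivative (\<lambda>h. D (h *\<^sub>R V))) (at 0)"
    "((\<lambda>t. ?G (to_complex (\<sigma> t))) has_derivative (\<lambda>h. E (h *\<^sub>R V))) (at 0)"
    using has_derivative_compose[OF *, of ?F D] has_derivative_compose[OF *, of ?G E] D E
    by (simp_all add: p_def)
  then have "(\<lambda>h. D (h *\<^sub>R V)) = (\<lambda>h. E (h *\<^sub>R V))"
    unfolding to_complex_inverse \<sigma>(2) by (rule has_derivative_unique)
  then have "D (1 *\<^sub>R V) = E (1 *\<^sub>R V)"
    by meson
  then have DE: "D 1 = E 1"
    using D'[of V] E'[of V] V by simp
  have D1: "D 1 \<noteq> 0"
    using D(2) by auto
  define w where "w = to_complex (f p)"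
  \<comment> \<open>\<open>cosh_dist\<close> from \<open>q\<close> as a function on the complex
    plane, and its derivative.\<close>
  define \<phi> where "\<phi> q w = ((Re (to_complex q) - Re w)\<^sup>2 + (Im (to_complex q))\<^sup>2 + (Im w)\<^sup>2) /
      (2 * Im (to_complex q) * Im w)" for q w
  define \<phi>' where "\<phi>' q w v = Re v * ((Re w - Re (to_complex q)) / (Im (to_complex q) * Im w)) +
      Im v * (((Im w)\<^sup>2 - (Re (to_complex q) - Re w)\<^sup>2 - (Im (to_complex q))\<^sup>2) /
        (2 * Im (to_complex q) * (Im w)\<^sup>2))" for q w v
  have \<phi>: "\<phi> q (to_complex q') = cosh_dist q q'" for q q'
    using Im_to_complex[of q] Im_to_complex[of q'] cosh_dist_mult[of q q']
    by (simp add: \<phi>_def field_simps)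
  have \<phi>': "(\<phi> q has_derivative \<phi>' q (to_complex q')) (at (to_complex q'))" for q q'
    unfolding \<phi>_def \<phi>'_def by (rule has_derivative_cosh_dist) (rule Im_to_complex)+
  have Fw: "?F ?z = w" "?G ?z = w"
    by (simp_all add: w_def to_complex_inverse fg)
  \<comment> \<open>Differentiate \<open>cosh_dist (k a) (k z) = cosh_dist a z\<close> with respect
    to \<open>z\<close> at \<open>p\<close>.\<close>
  have inv: "\<phi>' (k a) w (L v) = \<phi>' a ?z v"
    if k: "isometry k" and L: "((\<lambda>z. to_complex (k (of_complex z))) has_derivative L) (at ?z)"
      and kp: "k p = f p" for k L v
  proof -
    have "((\<lambda>z. \<phi> (k a) (to_complex (k (of_complex z)))) has_derivative (\<lambda>v. \<phi>' (k a) w (L v))) (at ?z)"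
      using has_derivative_compose[OF L, of "\<phi> (k a)" "\<phi>' (k a) w"] \<phi>'[of "k a" "f p"]
      by (simp add: to_complex_inverse kp w_def)
    moreover have "eventually (\<lambda>z. \<phi> (k a) (to_complex (k (of_complex z))) = \<phi> a z) (at ?z)"
      using eventually_at_to_complex_Im_pos[of p]
    proof eventually_elim
      case (elim z)
      then have "\<phi> a z = cosh_dist a (of_complex z)"
        using \<phi>[of a "of_complex z"] by (simp add: of_complex_inverse)
      then show ?case
        by (simp add: \<phi> isometry_cosh_dist[OF k])
    qed
    ultimately have "(\<phi> a has_derivative (\<lambda>v. \<phi>' (k a) w (L v))) (at ?z)"
      by (rule has_derivative_transform_eventually)
        (simp_all add: \<phi> to_complex_inverse isometry_cosh_dist[OF k])
    from fun_cong[OF has_derivative_unique[OF this \<phi>'], of v] show ?thesis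
      by simp
  qed
  \<comment> \<open>The common derivative of \<open>f\<close> and \<open>g\<close> at
    \<open>p\<close> is invertible, so every direction \<open>v\<close> at \<open>f p\<close> is
    reached.\<close>
  have grad: "\<phi>' (f a) w v = \<phi>' (g a) w v" for v
  proof -
    have "D (v / D 1) = v" "E (v / D 1) = v"
      using D'[of "v / D 1"] E'[of "v / D 1"] D1 DE by simp_all
    then show ?thesis
      using inv[OF f(1) D(1), of "v / D 1"] inv[OF g(1) E(1), of "v / D 1"] fg by simp
  qed
  show "f a = g a"
  proof (rule cosh_dist_gradient_inject[of _ "f p"])
    show "cosh_dist (f a) (f p) = cosh_dist (g a) (f p)"
      using isometry_cosh_dist[OF f(1), of a p] isometry_cosh_dist[OF g(1), of a p] fg by simp
  qed (use grad[of 1] grad[of \<i>] in \<open>simp_all add: \<phi>'_def w_def\<close>)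
qed

section \<open>Discrete groups of isometries\<close>

text \<open>A bounded sequence is Euclidean bounded and stays at height at least
  \<open>1 / (2 * C)\<close>, so a Euclidean subsequential limit lies in the half-plane and is also
  a limit for \<open>dist\<close>.\<close>

instance hyp_plane :: heine_borel
proof
  fix f :: "nat \<Rightarrow> hyp_plane"
  assume "bounded (range f)"
  define z0 where "z0 = of_complex \<i>"
  have z0: "to_complex z0 = \<i>"
    by (simp add: z0_def of_complex_inverse)
  obtain M where M: "\<And>n. dist z0 (f n) \<le> M"
    using \<open>bounded (range f)\<close> bounded_any_center[of "range f" z0] by auto
  define C where "C = cosh M"
  have C: "C > 0"
    by (simp add: C_def)
  \<comment> \<open>Membership in a hyperbolic ball about i, cleared of denominators; both Euclidean
    bounds are read off from it.\<close>
  have *: "(Re (to_complex (f n)))\<^sup>2 + (Im (to_complex (f n)))\<^sup>2 + 1 \<le> 2 * C * Im (to_complex (f n))" for n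
  proof -
    have "cosh (dist z0 (f n)) \<le> C"
      unfolding C_def using M[of n] by (subst cosh_real_nonneg_le_iff) (auto intro: order_trans[OF zero_le_dist])
    then have "cosh_dist z0 (f n) \<le> C"
      by (simp add: dist_hyp_plane_def cosh_dist_ge_1)
    then have "cosh_dist z0 (f n) * (2 * Im (to_complex (f n))) \<le> C * (2 * Im (to_complex (f n)))"
      using Im_to_complex[of "f n"] by (intro mult_right_mono) auto
    then show ?thesis
      using cosh_dist_mult[of z0 "f n"] by (simp add: z0 algebra_simps)
  qed
  have lower: "Im (to_complex (f n)) \<ge> 1 / (2 * C)" for n
  proof -
    have "1 \<le> 2 * C * Im (to_complex (f n))"
      using *[of n] by (smt (verit) zero_le_power2)
    then show ?thesis
      using C by (simp add: field_simps)
  qed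
  have "cmod (to_complex (f n)) \<le> 2 * C" for n
  proof -
    have "(cmod (to_complex (f n)))\<^sup>2 \<le> 2 * C * Im (to_complex (f n))"
      using *[of n] by (simp add: cmod_power2)
    also have "\<dots> \<le> 2 * C * cmod (to_complex (f n))"
      using C abs_Im_le_cmod[of "to_complex (f n)"] by simp
    finally show ?thesis
      using Im_to_complex[of "f n"] by (auto simp: power2_eq_square mult_le_cancel_right)
  qed
  then have "bounded (range (\<lambda>n. to_complex (f n)))"
    unfolding bounded_iff by blast
  then obtain l r where r: "strict_mono r" and lim: "((\<lambda>n. to_complex (f n)) \<circ> r) \<longlonglongrightarrow> l"
    using bounded_imp_convergent_subsequence by blast
  have lim: "(\<lambda>n. to_complex (f (r n))) \<longlonglongrightarrow> l"
    using lim by (simp add: o_def comp_def)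
  have "1 / (2 * C) \<le> Im l"
    using tendsto_Im[OF lim] by (rule LIMSEQ_le_const) (use lower in auto)
  then have l: "Im l > 0"
    using C by (smt (verit) divide_pos_pos)
  define L where "L = of_complex l"
  have L: "to_complex L = l"
    using l by (simp add: L_def of_complex_inverse)
  have "(\<lambda>n. cosh_dist (f (r n)) L) \<longlonglongrightarrow> 1 + (cmod (l - l))\<^sup>2 / (2 * Im l * Im l)"
    unfolding cosh_dist_def L using l by (intro tendsto_intros lim) auto
  then have "(\<lambda>n. arcosh (cosh_dist (f (r n)) L)) \<longlonglongrightarrow> arcosh 1"
    by (intro tendsto_arcosh_strong) (simp_all add: cosh_dist_ge_1)
  then have "(\<lambda>n. dist (f (r n)) L) \<longlonglongrightarrow> 0"
    by (simp add: dist_hyp_plane_def)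
  then have "(f \<circ> r) \<longlonglongrightarrow> L"
    by (subst tendsto_dist_iff) (simp add: comp_def)
  then show "\<exists>l r. strict_mono r \<and> (f \<circ> r) \<longlonglongrightarrow> l"
    using r by blast
qed

lemma isometry_dist: "isometry f \<Longrightarrow> dist (f p) (f q) = dist p q"
  by (simp add: isometry_def)

text \<open>Subsequences are refined one point at a time. Finitely many points suffice later, since
  a basic neighbourhood for pointwise convergence constrains only finitely many values.\<close>

lemma convergent_subsequence_finite:
  fixes g :: "nat \<Rightarrow> 'a \<Rightarrow> 'b::heine_borel"
  assumes "finite F" "\<And>i. i \<in> F \<Longrightarrow> bounded (range (\<lambda>n. g n i))"
  obtains r :: "nat \<Rightarrow> nat" where "strict_mono r" "\<And>i. i \<in> F \<Longrightarrow> convergent (\<lambda>n. g (r n) i)"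
proof -
  have "\<exists>r::nat \<Rightarrow> nat. strict_mono r \<and> (\<forall>i\<in>F. convergent (\<lambda>n. g (r n) i))"
    using assms
  proof (induction F rule: finite_induct)
    case empty
    show ?case
      by (auto intro!: exI[of _ id] simp: strict_mono_def)
  next
    case (insert j F)
    then obtain r :: "nat \<Rightarrow> nat" where r: "strict_mono r" "\<forall>i\<in>F. convergent (\<lambda>n. g (r n) i)"
      by auto
    have "bounded (range (\<lambda>n. g (r n) j))"
      using insert.prems[OF insertI1] by (rule bounded_subset) auto
    then obtain l r' where r': "strict_mono r'" "((\<lambda>n. g (r n) j) \<circ> r') \<longlonglongrightarrow> l"
      using bounded_imp_convergent_subsequence by blast
    have "convergent (\<lambda>n. g (r (r' n)) i)" if "i \<in> insert j F" for i
    proof (cases "i = j")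
      case True
      then show ?thesis
        using r'(2) by (auto simp: convergent_def comp_def)
    next
      case False
      then show ?thesis
        using that r(2) convergent_subseq_convergent[OF _ r'(1), of "\<lambda>n. g (r n) i"]
        by (auto simp: comp_def)
    qed
    then show ?case
      using strict_mono_compose[OF r(1) r'(1)] by (intro exI[of _ "\<lambda>n. r (r' n)"]) auto
  qed
  then show ?thesis
    using that by blast
qed

text \<open>Along a subsequence the values at finitely many test points are Cauchy, so the quotients
  of late members are close to the identity there; discreteness makes such a quotient the
  identity.\<close>

lemma isometry_group_discrete_bounded_orbit:
  assumes \<Gamma>: "isometry_group \<Gamma>" "discrete \<Gamma>"
    and g: "\<And>n. g n \<in> \<Gamma>" and bdd: "bounded (range (\<lambda>n::nat. g n p))"
  obtains m n where "m < n" "g m = g n"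
proof -
  have iso: "isometry f" "inv f \<in> \<Gamma>" if "f \<in> \<Gamma>" for f
    using \<Gamma>(1) that by (auto simp: isometry_group_def)
  obtain T where T: "open T" "T \<inter> \<Gamma> = {id}"
    using \<Gamma> by (auto simp: isometry_group_def discrete_def isolated_in_def)
  then have "openin (product_topology (\<lambda>i. euclidean) UNIV) T" "id \<in> T"
    by (auto simp: open_fun_def)
  from product_topology_open_contains_basis[OF this]
  obtain X where X: "id \<in> Pi\<^sub>E UNIV X" "\<And>i. open (X i)" "finite {i. X i \<noteq> UNIV}" "Pi\<^sub>E UNIV X \<subseteq> T"
    by auto
  let ?F = "{i. X i \<noteq> UNIV}"
  \<comment> \<open>Isometries preserve the distance from \<open>i\<close> to \<open>p\<close>, so
    one bounded orbit bounds all others.\<close>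
  have bdd': "bounded (range (\<lambda>n. g n i))" for i
  proof -
    obtain M where M: "\<And>n. dist p (g n p) \<le> M"
      using bdd bounded_any_center[of _ p] by auto
    have "dist p (g n i) \<le> M + dist p i" for n
      using dist_triangle[of p "g n i" "g n p"] M[of n] isometry_dist[OF iso(1)[OF g[of n]], of p i] by linarith
    then show ?thesis
      unfolding bounded_def by blast
  qed
  obtain r :: "nat \<Rightarrow> nat" where r: "strict_mono r" "\<And>i. i \<in> ?F \<Longrightarrow> convergent (\<lambda>n. g (r n) i)"
    using convergent_subsequence_finite[of ?F g] X(3) bdd' by metis
  have ev: "eventually (\<lambda>(m, n). inv (g (r m)) (g (r n) i) \<in> X i) (sequentially \<times>\<^sub>F sequentially)" if "i \<in> ?F" for i
  proof -
    have "i \<in> X i"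
      using X(1) by (auto simp: PiE_iff)
    then obtain \<epsilon> where \<epsilon>: "\<epsilon> > 0" "ball i \<epsilon> \<subseteq> X i"
      using X(2) open_contains_ball by blast
    have "Cauchy (\<lambda>n. g (r n) i)"
      using r(2)[OF that] by (rule convergent_Cauchy)
    then obtain N where N: "\<And>m n. m \<ge> N \<Longrightarrow> n \<ge> N \<Longrightarrow> dist (g (r m) i) (g (r n) i) < \<epsilon>"
      using \<epsilon>(1) unfolding Cauchy_def by blast
    have "inv (g (r m)) (g (r n) i) \<in> X i" if "m \<ge> N" "n \<ge> N" for m n
    proof -
      have "inv (g (r m)) (g (r m) i) = i"
        using iso(1)[OF g[of "r m"]] by (simp add: isometry_def bij_is_inj)
      \<comment> \<open>Applying the isometry \<open>inv (g (r m))\<close> converts closeness of two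
        images of \<open>i\<close> into closeness of the quotient to the identity at
        \<open>i\<close>.\<close>
      then have "dist i (inv (g (r m)) (g (r n) i)) = dist (g (r m) i) (g (r n) i)"
        using isometry_dist[OF iso(1)[OF iso(2)[OF g[of "r m"]]], of "g (r m) i" "g (r n) i"] by simp
      then show ?thesis
        using N[OF that] \<epsilon>(2) by auto
    qed
    then show ?thesis
      unfolding eventually_prod_sequentially by (intro exI[of _ N]) auto
  qed
  have "eventually (\<lambda>x. \<forall>i\<in>?F. case x of (m, n) \<Rightarrow> inv (g (r m)) (g (r n) i) \<in> X i) (sequentially \<times>\<^sub>F sequentially)"
    using X(3) by (rule eventually_ball_finite) (use ev in blast)
  then have "\<exists>N. \<forall>m\<ge>N. \<forall>n\<ge>N. \<forall>i\<in>?F. inv (g (r n)) (g (r m) i) \<in> X i"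
    unfolding eventually_prod_sequentially by simp
  then obtain N where N: "\<And>m n i. m \<ge> N \<Longrightarrow> n \<ge> N \<Longrightarrow> i \<in> ?F \<Longrightarrow> inv (g (r n)) (g (r m) i) \<in> X i"
    by blast
  let ?h = "inv (g (r N)) \<circ> g (r (Suc N))"
  have "?h \<in> Pi\<^sub>E UNIV X"
    using N[of "Suc N" N] by (auto simp: PiE_iff)
  moreover have "?h \<in> \<Gamma>"
    using \<Gamma>(1) g by (auto simp: isometry_group_def)
  ultimately have h: "?h = id"
    using X(4) T(2) by blast
  have "g (r N) = g (r N) \<circ> ?h"
    by (simp add: h)
  also have "\<dots> = g (r (Suc N))"
    using iso(1)[OF g[of "r N"]] by (simp add: fun_eq_iff isometry_def bij_is_surj surj_f_inv_f)
  finally show ?thesis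
    using that[of "r N" "r (Suc N)"] r(1) by (simp add: strict_mono_def)
qed

text \<open>All powers of \<open>f\<close> fix \<open>p\<close>, so two of them coincide by
  discreteness; injectivity yields a positive power equal to \<open>id\<close>, and torsion-freeness
  applies.\<close>

lemma hyperbolic_surface_group_fixed_point:
  assumes \<Gamma>: "hyperbolic_surface_group \<Gamma>" and f: "f \<in> \<Gamma>" "f p = p"
  shows "f = id"
proof -
  have G: "isometry_group \<Gamma>" "discrete \<Gamma>" "torsion_free \<Gamma>"
    using \<Gamma> by (auto simp: hyperbolic_surface_group_def)
  have pow: "f ^^ n \<in> \<Gamma>" for n
  proof (induction n)
    case 0
    then show ?case
      using G(1) by (simp add: isometry_group_def id_def)
  next
    case (Suc n)
    then show ?case
      using G(1) f(1) unfolding isometry_group_def funpow.simps by blast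
  qed
  have "(f ^^ n) p = p" for n
    by (induction n) (simp_all add: f(2))
  then have "bounded (range (\<lambda>n. (f ^^ n) p))"
    by simp
  then obtain m n where mn: "m < n" "f ^^ m = f ^^ n"
    using isometry_group_discrete_bounded_orbit[OF G(1,2), of "\<lambda>n. f ^^ n"] pow by blast
  have inj: "inj (f ^^ m)"
    using pow[of m] G(1) by (auto simp: isometry_group_def isometry_def bij_is_inj)
  have "f ^^ m \<circ> f ^^ (n - m) = f ^^ n"
    using mn(1) by (simp flip: funpow_add)
  then have "(f ^^ m) ((f ^^ (n - m)) x) = (f ^^ m) x" for x
    by (metis comp_apply mn(2))
  then have "f ^^ (n - m) = id"
    using injD[OF inj] by (auto simp: fun_eq_iff)
  then show ?thesis
    using G(3) f(1) mn(1) unfolding torsion_free_def by (meson zero_less_diff)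
qed

section \<open>Deck transformations along closed geodesics\<close>

lemma geodesic_line_shift: "geodesic_line \<sigma> \<Longrightarrow> geodesic_line (\<lambda>t. \<sigma> (t + l))"
  by (simp add: geodesic_line_def)

lemma geodesic_line_isometry: "geodesic_line \<sigma> \<Longrightarrow> isometry f \<Longrightarrow> geodesic_line (\<lambda>t. f (\<sigma> t))"
  by (simp add: geodesic_line_def isometry_dist)

text \<open>
  For each \<open>t\<close> some element of \<open>\<Gamma>\<close> maps \<open>\<sigma> t\<close> to \<open>\<sigma> (t + l)\<close>. By discreteness one element does this
  for two values of \<open>t\<close>, hence for all of them.
\<close>

lemma closed_geodesic_translation:
  assumes \<Gamma>: "isometry_group \<Gamma>" "discrete \<Gamma>"
    and \<sigma>: "geodesic_lift \<Gamma> \<gamma> \<sigma>" and per: "\<And>t. \<gamma> (t + l) = \<gamma> t"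
  obtains g where "g \<in> \<Gamma>" "\<And>t. g (\<sigma> t) = \<sigma> (t + l)"
proof -
  have geo: "geodesic_line \<sigma>"
    using \<sigma> by (simp add: geodesic_lift_def)
  have "\<exists>k\<in>\<Gamma>. k (\<sigma> t) = \<sigma> (t + l)" for t
  proof -
    have "\<sigma> (t + l) \<in> surface_proj \<Gamma> (\<sigma> (t + l))"
      using \<Gamma>(1) unfolding surface_proj_def isometry_group_def by (metis id_apply image_eqI)
    also have "\<dots> = surface_proj \<Gamma> (\<sigma> t)"
      using \<sigma> per[of t] by (simp add: geodesic_lift_def)
    finally show ?thesis
      by (auto simp: surface_proj_def)
  qed
  then obtain k where k: "\<And>t. k t \<in> \<Gamma>" "\<And>t. k t (\<sigma> t) = \<sigma> (t + l)"
    by metis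
  \<comment> \<open>Pairwise distinct times in a bounded interval: coinciding group elements then
    agree with the shift at two different times.\<close>
  define u :: "nat \<Rightarrow> real" where "u n = 1 / (real n + 1)" for n
  have u: "\<bar>u n\<bar> \<le> 1" for n
    by (simp add: u_def)
  \<comment> \<open>Both points lie within \<open>\<bar>u n\<bar>\<close> of
    \<open>\<sigma> (u n + l)\<close>.\<close>
  have "dist (\<sigma> l) (k (u n) (\<sigma> 0)) \<le> 2" for n
  proof -
    have "dist (k (u n) (\<sigma> 0)) (k (u n) (\<sigma> (u n))) = \<bar>u n\<bar>"
      using k(1)[of "u n"] \<Gamma>(1) geo by (simp add: isometry_group_def isometry_def geodesic_line_def)
    moreover have "dist (\<sigma> l) (\<sigma> (u n + l)) = \<bar>u n\<bar>"
      using geo by (simp add: geodesic_line_def)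
    ultimately show ?thesis
      using dist_triangle2[of "\<sigma> l" "k (u n) (\<sigma> 0)" "\<sigma> (u n + l)"] k(2)[of "u n"] u[of n] by simp
  qed
  then have "bounded (range (\<lambda>n. k (u n) (\<sigma> 0)))"
    unfolding bounded_def by blast
  then obtain m n where mn: "m < n" "k (u m) = k (u n)"
    using isometry_group_discrete_bounded_orbit[OF \<Gamma>, of "\<lambda>n. k (u n)"] k(1) by blast
  have "isometry (k (u m))"
    using k(1) \<Gamma>(1) by (simp add: isometry_group_def)
  moreover have "u m \<noteq> u n"
    using mn(1) by (simp add: u_def)
  ultimately have "(\<lambda>t. k (u m) (\<sigma> t)) = (\<lambda>t. \<sigma> (t + l))"
    by (rule geodesic_line_unique[OF geodesic_line_isometry[OF geo] geodesic_line_shift[OF geo]])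
      (use k(2)[of "u m"] k(2)[of "u n"] mn(2) in simp_all)
  then show ?thesis
    using that[of "k (u m)"] k(1) by meson
qed

section \<open>The commutator of two crossing translations\<close>

text \<open>Half turn matrices are linear in hyperboloid coordinates, so along a geodesic the matrix
  is \<open>cosh r\<close> times that of the base point plus \<open>sinh r\<close> times that of the
  direction vector.\<close>

lemma half_turn_geodesic_direction:
  assumes "geodesic_direction \<sigma> s c e"
  defines "x \<equiv> Re (to_complex (\<sigma> s))" and "y \<equiv> Im (to_complex (\<sigma> s))"
  shows "half_turn (\<sigma> (s + r)) = mobius
    ((x * cosh r + (y * c - x * e) * sinh r) / y)
    (- ((x\<^sup>2 + y\<^sup>2) * cosh r + (2 * x * y * c + (y\<^sup>2 - x\<^sup>2) * e) * sinh r) / y)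
    ((cosh r - e * sinh r) / y)
    (- (x * cosh r + (y * c - x * e) * sinh r) / y)"
proof -
  have y: "y > 0"
    by (simp add: y_def Im_to_complex)
  have 1: "c\<^sup>2 + e\<^sup>2 = 1"
    using assms(1) by (simp add: geodesic_direction_def)
  define C S K where "C = cosh r" and "S = sinh r" and "K = C - e * S"
  have K: "K > 0"
    using cosh_minus_sinh_pos[OF 1, of r] by (simp add: K_def C_def S_def)
  have CS: "C\<^sup>2 = 1 + S\<^sup>2"
    by (simp add: C_def S_def cosh_square_eq)
  have z: "to_complex (\<sigma> (s + r)) = Complex (x + y * c * S / K) (y / K)"
    using assms(1) unfolding geodesic_direction_def x_def y_def K_def C_def S_def by blast
  have 2: "(x + y * c * S / K) / (y / K) = (x * C + (y * c - x * e) * S) / y"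
    using y K by (simp add: field_simps) (simp add: K_def algebra_simps)
  \<comment> \<open>The unit length of \<open>(c, e)\<close> lets a factor \<open>K\<close> split
    off, leaving an expression linear in \<open>C\<close> and \<open>S\<close>.\<close>
  have "(K * x + y * c * S)\<^sup>2 + y\<^sup>2 = K * ((x\<^sup>2 + y\<^sup>2) * C + (2 * x * y * c + (y\<^sup>2 - x\<^sup>2) * e) * S)"
    unfolding K_def using 1 CS by algebra
  moreover have "((x + y * c * S / K)\<^sup>2 + (y / K)\<^sup>2) / (y / K) = ((K * x + y * c * S)\<^sup>2 + y\<^sup>2) / (y * K)"
    using y K by (simp add: field_simps power2_eq_square)
  ultimately have 3: "((x + y * c * S / K)\<^sup>2 + (y / K)\<^sup>2) / (y / K) =
      ((x\<^sup>2 + y\<^sup>2) * C + (2 * x * y * c + (y\<^sup>2 - x\<^sup>2) * e) * S) / y"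
    using K by simp
  show ?thesis
    unfolding half_turn_def Let_def z complex.sel minus_divide_left[symmetric] 2 3
    by (simp add: K_def C_def S_def)
qed

text \<open>The trace of a product of three traceless 2 by 2 matrices is alternating in them. As the
  base point itself is one of the three, the \<open>cosh\<close> terms vanish and only the
  determinant of the two directions remains.\<close>

lemma half_turn_product_trace:
  assumes \<sigma>: "geodesic_direction \<sigma> s c e" and \<tau>: "geodesic_direction \<tau> t c' e'" and eq: "\<sigma> s = \<tau> t"
  obtains m11 m12 m21 m22 where "m11 * m22 - m12 * m21 = 1"
    "\<And>q. half_turn (\<sigma> (s + r)) (half_turn (\<tau> (t + r')) (half_turn (\<sigma> s) q)) = mobius m11 m12 m21 m22 q"
    "m11 + m22 = - 2 * sinh r * sinh r' * (c * e' - c' * e)"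
proof -
  define x y where "x = Re (to_complex (\<sigma> s))" and "y = Im (to_complex (\<sigma> s))"
  have y: "y > 0"
    by (simp add: y_def Im_to_complex)
  define \<alpha> \<beta> \<kappa> where "\<alpha> c e r = (x * cosh r + (y * c - x * e) * sinh r) / y"
    and "\<beta> c e r = - ((x\<^sup>2 + y\<^sup>2) * cosh r + (2 * x * y * c + (y\<^sup>2 - x\<^sup>2) * e) * sinh r) / y"
    and "\<kappa> c e r = (cosh r - e * sinh r) / y" for c e r :: real
  have det: "\<alpha> c e r * (- \<alpha> c e r) - \<beta> c e r * \<kappa> c e r = 1" if "c\<^sup>2 + e\<^sup>2 = 1" for c e r
  proof -
    define C S where "C = cosh r" and "S = sinh r"
    have CS: "C\<^sup>2 = 1 + S\<^sup>2"
      by (simp add: C_def S_def cosh_square_eq)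
    have *: "y * \<alpha> c e r = x * C + (y * c - x * e) * S"
      "y * \<beta> c e r = - ((x\<^sup>2 + y\<^sup>2) * C + (2 * x * y * c + (y\<^sup>2 - x\<^sup>2) * e) * S)"
      "y * \<kappa> c e r = C - e * S"
      using y by (simp_all add: \<alpha>_def \<beta>_def \<kappa>_def C_def S_def)
    have "y\<^sup>2 * (\<alpha> c e r * (- \<alpha> c e r) - \<beta> c e r * \<kappa> c e r) =
        - (y * \<alpha> c e r)\<^sup>2 - (y * \<beta> c e r) * (y * \<kappa> c e r)"
      by algebra
    also have "\<dots> = y\<^sup>2"
      unfolding * using that CS by algebra
    finally show ?thesis
      using y by simp
  qed
  have unit: "c\<^sup>2 + e\<^sup>2 = 1" and unit': "c'\<^sup>2 + e'\<^sup>2 = 1"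
    using \<sigma> \<tau> by (simp_all add: geodesic_direction_def)
  define A B K where "A = \<alpha> c e r" and "B = \<beta> c e r" and "K = \<kappa> c e r"
  define A' B' K' where "A' = \<alpha> c' e' r'" and "B' = \<beta> c' e' r'" and "K' = \<kappa> c' e' r'"
  have h: "half_turn (\<sigma> (s + r)) = mobius A B K (- A)"
    unfolding half_turn_geodesic_direction[OF \<sigma>]
    by (simp only: A_def B_def K_def \<alpha>_def \<beta>_def \<kappa>_def x_def y_def minus_divide_left)
  have h': "half_turn (\<tau> (t + r')) = mobius A' B' K' (- A')"
    unfolding half_turn_geodesic_direction[OF \<tau>]
    by (simp only: A'_def B'_def K'_def \<alpha>_def \<beta>_def \<kappa>_def x_def y_def eq minus_divide_left)
  have h0: "half_turn (\<sigma> s) = mobius (x / y) (- (x\<^sup>2 + y\<^sup>2) / y) (1 / y) (- x / y)"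
    by (simp add: half_turn_def Let_def x_def y_def)
  have d: "A * (- A) - B * K = 1" and d': "A' * (- A') - B' * K' = 1"
    unfolding A_def B_def K_def A'_def B'_def K'_def by (rule det[OF unit], rule det[OF unit'])
  have d0: "(x / y) * (- x / y) - (- (x\<^sup>2 + y\<^sup>2) / y) * (1 / y) = 1"
    using y by (intro half_turn_det) simp
  \<comment> \<open>Naming the quotients lets the trace, multiplied by \<open>y ^ 3\<close>, be
    treated as a polynomial identity.\<close>
  define P Q where "P = x / y" and "Q = (x\<^sup>2 + y\<^sup>2) / y"
  have yP: "y * P = x" "y * Q = x\<^sup>2 + y\<^sup>2"
    using y by (simp_all add: P_def Q_def)
  have yA: "y * A = x * cosh r + (y * c - x * e) * sinh r"
    "y * B = - ((x\<^sup>2 + y\<^sup>2) * cosh r + (2 * x * y * c + (y\<^sup>2 - x\<^sup>2) * e) * sinh r)"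
    "y * K = cosh r - e * sinh r"
    "y * A' = x * cosh r' + (y * c' - x * e') * sinh r'"
    "y * B' = - ((x\<^sup>2 + y\<^sup>2) * cosh r' + (2 * x * y * c' + (y\<^sup>2 - x\<^sup>2) * e') * sinh r')"
    "y * K' = cosh r' - e' * sinh r'"
    using y by (simp_all add: A_def B_def K_def A'_def B'_def K'_def \<alpha>_def \<beta>_def \<kappa>_def)
  define R where "R = 1 / y"
  have yR: "y * R = 1"
    using y by (simp add: R_def)
  show ?thesis
  proof (rule that)
    note dd = mobius_det_mult[OF d d']
    show "half_turn (\<sigma> (s + r)) (half_turn (\<tau> (t + r')) (half_turn (\<sigma> s) q)) = mobius
      ((A * A' + B * K') * (x / y) + (A * B' + B * - A') * (1 / y))
      ((A * A' + B * K') * (- (x\<^sup>2 + y\<^sup>2) / y) + (A * B' + B * - A') * (- x / y))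
      ((K * A' + - A * K') * (x / y) + (K * B' + - A * - A') * (1 / y))
      ((K * A' + - A * K') * (- (x\<^sup>2 + y\<^sup>2) / y) + (K * B' + - A * - A') * (- x / y)) q" for q
      unfolding h h' h0 mobius_mobius[OF d d'] mobius_mobius[OF dd d0] by (rule refl)
    show "((A * A' + B * K') * (x / y) + (A * B' + B * - A') * (1 / y)) *
      ((K * A' + - A * K') * (- (x\<^sup>2 + y\<^sup>2) / y) + (K * B' + - A * - A') * (- x / y)) -
      ((A * A' + B * K') * (- (x\<^sup>2 + y\<^sup>2) / y) + (A * B' + B * - A') * (- x / y)) *
      ((K * A' + - A * K') * (x / y) + (K * B' + - A * - A') * (1 / y)) = 1"
      by (rule mobius_det_mult[OF dd d0])
    have "y ^ 3 * ((A * A' + B * K') * P + (A * B' + B * - A') * R +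
        ((K * A' + - A * K') * (- Q) + (K * B' + - A * - A') * (- P))) =
        ((y * A) * (y * A') + (y * B) * (y * K')) * (y * P) + ((y * A) * (y * B') - (y * B) * (y * A')) * (y * R) -
        ((y * K) * (y * A') - (y * A) * (y * K')) * (y * Q) - ((y * K) * (y * B') + (y * A) * (y * A')) * (y * P)"
      by algebra
    also have "\<dots> = y ^ 3 * (- 2 * sinh r * sinh r' * (c * e' - c' * e))"
      unfolding yA yP yR by algebra
    finally have "(A * A' + B * K') * P + (A * B' + B * - A') * R +
        ((K * A' + - A * K') * (- Q) + (K * B' + - A * - A') * (- P)) =
        - 2 * sinh r * sinh r' * (c * e' - c' * e)"
      using y by (subst (asm) mult_left_cancel) simp_all
    then show "(A * A' + B * K') * (x / y) + (A * B' + B * - A') * (1 / y) +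
      ((K * A' + - A * K') * (- (x\<^sup>2 + y\<^sup>2) / y) + (K * B' + - A * - A') * (- x / y)) =
      - 2 * sinh r * sinh r' * (c * e' - c' * e)"
      by (simp only: P_def Q_def R_def minus_divide_left)
  qed
qed

lemma half_turn_comp_isometry:
  "isometry (half_turn q \<circ> half_turn q')" "orientation_preserving (half_turn q \<circ> half_turn q')"
proof -
  obtain a b c d where 1: "a * d - b * c = 1" "half_turn q = mobius a b c d"
    using mobius_half_turn by blast
  obtain a' b' c' d' where 2: "a' * d' - b' * c' = 1" "half_turn q' = mobius a' b' c' d'"
    using mobius_half_turn by blast
  have "half_turn q \<circ> half_turn q' =
      mobius (a * a' + b * c') (a * b' + b * d') (c * a' + d * c') (c * b' + d * d')"
    by (simp add: fun_eq_iff 1(2) 2(2) mobius_mobius[OF 1(1) 2(1)])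
  then show "isometry (half_turn q \<circ> half_turn q')" "orientation_preserving (half_turn q \<circ> half_turn q')"
    using isometry_mobius orientation_preserving_mobius mobius_det_mult[OF 1(1) 2(1)] by metis+
qed

text \<open>On the line the half turns act as t -> 2 s - t and t -> 2 s + l - t, with composite t ->
  t + l; orientation preserving isometries agreeing on a line are equal.\<close>

lemma translation_eq_half_turns:
  assumes \<sigma>: "geodesic_line \<sigma>" and g: "isometry g" "orientation_preserving g"
    and gs: "\<And>t. g (\<sigma> t) = \<sigma> (t + l)"
  shows "g = half_turn (\<sigma> (s + l / 2)) \<circ> half_turn (\<sigma> s)"
proof (rule orientation_preserving_isometry_eqI[OF g half_turn_comp_isometry \<sigma>])
  fix t
  have "half_turn (\<sigma> s) (\<sigma> t) = \<sigma> (2 * s - t)"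
    using half_turn_geodesic_line[OF \<sigma>, of s "t - s"] by (simp add: algebra_simps)
  moreover have "half_turn (\<sigma> (s + l / 2)) (\<sigma> (2 * s - t)) = \<sigma> (t + l)"
    using half_turn_geodesic_line[OF \<sigma>, of "s + l / 2" "s - t - l / 2"] by (simp add: algebra_simps)
  ultimately show "g (\<sigma> t) = (half_turn (\<sigma> (s + l / 2)) \<circ> half_turn (\<sigma> s)) (\<sigma> t)"
    by (simp add: gs)
qed

lemma inv_half_turns: "inv (half_turn q \<circ> half_turn q') = half_turn q' \<circ> half_turn q"
  by (rule inv_unique_comp) (simp_all add: fun_eq_iff half_turn_half_turn)

text \<open>The left side is half the modulus of the trace. A fixed point only forces the square of
  the triple product to be the identity, which also happens at trace zero; transversality excludes
  that case.\<close>

lemma crossing_translations_sinh_bound: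
  assumes \<Gamma>: "orientable_hyperbolic_surface_group \<Gamma>"
    and \<sigma>: "geodesic_line \<sigma>" "geodesic_direction \<sigma> s c e" and \<tau>: "geodesic_line \<tau>" "geodesic_direction \<tau> t c' e'"
    and eq: "\<sigma> s = \<tau> t" and transverse: "c * e' - c' * e \<noteq> 0"
    and g: "g \<in> \<Gamma>" "\<And>t. g (\<sigma> t) = \<sigma> (t + l)" and h: "h \<in> \<Gamma>" "\<And>t. h (\<tau> t) = \<tau> (t + l')"
    and l: "l > 0" "l' > 0"
  shows "sinh (l / 2) * sinh (l' / 2) * \<bar>c * e' - c' * e\<bar> \<ge> 1"
proof (rule ccontr)
  assume small: "\<not> ?thesis"
  have G: "isometry_group \<Gamma>" and or: "\<And>f. f \<in> \<Gamma> \<Longrightarrow> orientation_preserving f"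
    and surf: "hyperbolic_surface_group \<Gamma>"
    using \<Gamma> by (auto simp: orientable_hyperbolic_surface_group_def hyperbolic_surface_group_def)
  have iso: "\<And>f. f \<in> \<Gamma> \<Longrightarrow> isometry f"
    using G by (simp add: isometry_group_def)
  let ?A = "half_turn (\<sigma> (s + l / 2))" and ?B = "half_turn (\<tau> (t + l' / 2))" and ?P = "half_turn (\<sigma> s)"
  have g': "g = ?A \<circ> ?P"
    by (rule translation_eq_half_turns[OF \<sigma>(1) iso or g(2)]) (rule g(1))+
  have h': "h = ?B \<circ> ?P"
    unfolding eq by (rule translation_eq_half_turns[OF \<tau>(1) iso or h(2)]) (rule h(1))+
  obtain m11 m12 m21 m22 where det: "m11 * m22 - m12 * m21 = 1"
    and M: "\<And>q. ?A (?B (?P q)) = mobius m11 m12 m21 m22 q"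
    and tr: "m11 + m22 = - 2 * sinh (l / 2) * sinh (l' / 2) * (c * e' - c' * e)"
    by (rule half_turn_product_trace[OF \<sigma>(2) \<tau>(2) eq, of "l / 2" "l' / 2"]) (rule that)
  have "\<bar>m11 + m22\<bar> = 2 * (sinh (l / 2) * sinh (l' / 2) * \<bar>c * e' - c' * e\<bar>)"
    unfolding tr using l by (simp add: abs_mult)
  then have "\<bar>m11 + m22\<bar> < 2"
    using small by simp
  then obtain q where q: "mobius m11 m12 m21 m22 q = q"
    using mobius_elliptic_fixed_point[OF det] by blast
  \<comment> \<open>The product of half turns need not lie in the group; its square \<open>k\<close>
    does.\<close>
  define k where "k = (g \<circ> inv h) \<circ> (inv g \<circ> h)"
  have k: "k p = mobius m11 m12 m21 m22 (mobius m11 m12 m21 m22 p)" for p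
    unfolding k_def g' h' inv_half_turns M[symmetric] by (simp add: half_turn_half_turn)
  have "k \<in> \<Gamma>"
    using G g(1) h(1) by (simp add: k_def isometry_group_def del: comp_assoc)
  then have "k = id"
    by (rule hyperbolic_surface_group_fixed_point[OF surf, where p = q]) (simp add: k q)
  then have "mobius m11 m12 m21 m22 (mobius m11 m12 m21 m22 p) = p" for p
    using k[of p] by simp
  then consider "m11 + m22 = 0" | "m21 = 0"
    using mobius_square_eq_id[OF det] by blast
  then show False
  proof cases
    case 1
    then show ?thesis
      using tr l transverse by simp
  next
    case 2
    then have "(m11 + m22)\<^sup>2 = 4 + (m11 - m22)\<^sup>2"
      using det by (simp add: power2_eq_square algebra_simps)
    then have "2\<^sup>2 \<le> \<bar>m11 + m22\<bar>\<^sup>2"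
      by simp
    then have "2 \<le> \<bar>m11 + m22\<bar>"
      by (rule power2_le_imp_le) simp
    then show ?thesis
      using \<open>\<bar>m11 + m22\<bar> < 2\<close> by simp
  qed
qed

section \<open>Angles between geodesics\<close>

text \<open>With \<open>x = exp (- (a + b))\<close> the claimed bound is
  \<open>4 * arctan x\<close>. Since \<open>cosh (a - b)\<close> is at least 1,
  \<open>sinh a * sinh b\<close> is at most (1 - x)^2 / (4 x), and for smaller angles the assumption
  would contradict (1 - x)^2 (1 - x^2) < (1 + x^2)^2.\<close>

lemma parallelism_angle_less:
  assumes ab: "a > 0" "b > 0" and \<theta>: "0 \<le> \<theta>" "\<theta> \<le> pi" and le: "sinh a * sinh b * sin \<theta> \<ge> 1"
  shows "2 * parallelism_angle (a + b) < \<theta>"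
proof (rule ccontr)
  assume neg: "\<not> ?thesis"
  define x where "x = exp (- (a + b))"
  have x: "0 < x" "x < 1"
    using ab by (simp_all add: x_def)
  define \<phi> where "\<phi> = arctan x"
  have \<phi>: "0 < \<phi>" "\<phi> < pi / 4"
    using x arctan_less_iff[of x 1] by (simp_all add: \<phi>_def arctan_one)
  have "2 * (sinh a * sinh b) = cosh (a + b) - cosh (a - b)"
    by (simp add: cosh_add cosh_diff)
  also have "\<dots> \<le> cosh (a + b) - 1"
    using cosh_real_ge_1[of "a - b"] by simp
  also have "\<dots> = (1 - x)\<^sup>2 / (2 * x)"
    unfolding x_def cosh_def exp_minus by (simp add: field_simps power2_eq_square)
  finally have sinh: "sinh a * sinh b \<le> (1 - x)\<^sup>2 / (4 * x)"
    by simp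
  have "sin \<theta> \<ge> 0"
    using \<theta> by (rule sin_ge_zero)
  then have "1 \<le> (1 - x)\<^sup>2 / (4 * x) * sin \<theta>"
    using le mult_right_mono[OF sinh] by fastforce
  then have sin: "4 * x \<le> (1 - x)\<^sup>2 * sin \<theta>"
    using x by (simp add: field_simps)
  \<comment> \<open>The crude bound on the sine already makes \<open>x\<close> small enough for
    \<open>4 * \<phi>\<close> to stay below a right angle, where the sine is monotone.\<close>
  also have "\<dots> \<le> (1 - x)\<^sup>2"
    by (simp add: mult_left_le)
  finally have "4 * x \<le> (1 - x)\<^sup>2" .
  then have "6 * x \<le> 1 + x\<^sup>2"
    by (simp add: power2_eq_square algebra_simps)
  moreover have "x\<^sup>2 < x"
    using mult_strict_left_mono[OF x(2) x(1)] by (simp add: power2_eq_square)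
  ultimately have quad: "2 * x < 1 - x\<^sup>2"
    using x by linarith
  have sq: "sqrt (1 + x\<^sup>2) * sqrt (1 + x\<^sup>2) = 1 + x\<^sup>2" "1 + x\<^sup>2 > 0"
    by (simp_all add: add_pos_nonneg)
  have sin2: "sin (2 * \<phi>) = 2 * x / (1 + x\<^sup>2)"
    by (simp add: sin_double \<phi>_def sin_arctan cos_arctan sq)
  have cos2: "cos (2 * \<phi>) = (1 - x\<^sup>2) / (1 + x\<^sup>2)"
    by (simp add: cos_double \<phi>_def sin_arctan cos_arctan power_divide sq(2) less_imp_le diff_divide_distrib)
  \<comment> \<open>That is, sin 2\<phi> < cos 2\<phi>, which places 2\<phi> below pi / 4.\<close>
  have "cos (pi / 2 - 2 * \<phi>) < cos (2 * \<phi>)"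
    using quad sq(2) by (simp add: cos_diff sin2 cos2 divide_strict_right_mono)
  then have small: "2 * \<phi> < pi / 4"
    using \<phi> by (subst (asm) cos_mono_less_eq) auto
  have "\<theta> \<le> 4 * \<phi>"
    using neg by (simp add: parallelism_angle_def \<phi>_def x_def)
  then have "sin \<theta> \<le> sin (2 * (2 * \<phi>))"
    using \<theta>(1) small by (intro sin_monotone_2pi_le) auto
  also have "\<dots> = 4 * x * (1 - x\<^sup>2) / (1 + x\<^sup>2)\<^sup>2"
    unfolding sin_double[of "2 * \<phi>"] sin2 cos2 by (simp add: power2_eq_square)
  finally have "(1 - x)\<^sup>2 * sin \<theta> \<le> (1 - x)\<^sup>2 * (4 * x * (1 - x\<^sup>2) / (1 + x\<^sup>2)\<^sup>2)"
    by (rule mult_left_mono) simp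
  with sin have "4 * x \<le> (1 - x)\<^sup>2 * (4 * x * (1 - x\<^sup>2) / (1 + x\<^sup>2)\<^sup>2)"
    by (rule order_trans)
  also have "\<dots> = 4 * x * ((1 - x)\<^sup>2 * (1 - x\<^sup>2)) / (1 + x\<^sup>2)\<^sup>2"
    by simp
  finally have "4 * x * (1 + x\<^sup>2)\<^sup>2 \<le> 4 * x * ((1 - x)\<^sup>2 * (1 - x\<^sup>2))"
    using sq(2) by (subst (asm) pos_le_divide_eq) simp_all
  then have "(1 + x\<^sup>2)\<^sup>2 \<le> (1 - x)\<^sup>2 * (1 - x\<^sup>2)"
    using x by simp
  also have "\<dots> \<le> 1 * 1"
    using x by (intro mult_mono) (auto simp: power_le_one)
  also have "\<dots> < (1 + x\<^sup>2)\<^sup>2"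
    using x by (simp add: one_less_power)
  finally show False
    by simp
qed

text \<open>For unit vectors the squares of inner product and determinant add up to 1. Reversing one
  vector gives the supplementary angle, which has the same sine.\<close>

lemma intersection_angle_sin:
  assumes \<sigma>: "geodesic_direction \<sigma> s c e" and \<tau>: "geodesic_direction \<tau> t c' e'" and eq: "\<sigma> s = \<tau> t"
    and \<theta>: "\<theta> = vector_angle (velocity \<sigma> s) (velocity \<tau> t) \<or> \<theta> = vector_angle (velocity \<sigma> s) (- velocity \<tau> t)"
  shows "0 \<le> \<theta>" "\<theta> \<le> pi" "sin \<theta> = \<bar>c * e' - c' * e\<bar>"
proof -
  define y where "y = Im (to_complex (\<sigma> s))"
  have y: "y > 0"
    by (simp add: y_def Im_to_complex)
  have unit: "c\<^sup>2 + e\<^sup>2 = 1" "c'\<^sup>2 + e'\<^sup>2 = 1"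
    using \<sigma> \<tau> by (simp_all add: geodesic_direction_def)
  have v: "velocity \<sigma> s = y *\<^sub>R Complex c e" "velocity \<tau> t = y *\<^sub>R Complex c' e'"
    using geodesic_direction_velocity[OF \<sigma>] geodesic_direction_velocity[OF \<tau>] by (simp_all add: y_def eq)
  have n: "cmod (Complex c e) = 1" "cmod (Complex c' e') = 1"
    using unit by (simp_all add: cmod_def)
  have "vector_angle (y *\<^sub>R a) (y *\<^sub>R b) = arccos (a \<bullet> b)" if "cmod a = 1" "cmod b = 1" for a b
    using y that by (simp add: vector_angle_def)
  from this[OF n(1), of "Complex c' e'"] this[OF n(1), of "- Complex c' e'"]
  have "\<theta> = arccos (c * c' + e * e') \<or> \<theta> = arccos (- (c * c' + e * e'))"
    using \<theta> n unfolding v by (simp add: inner_complex_def)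
  then obtain d where d: "\<theta> = arccos d" "d\<^sup>2 = (c * c' + e * e')\<^sup>2"
    by (metis power2_minus)
  have "1 - d\<^sup>2 = (c * e' - c' * e)\<^sup>2"
    unfolding d using unit by algebra
  then have d1: "1 - d\<^sup>2 = (c * e' - c' * e)\<^sup>2" "- 1 \<le> d" "d \<le> 1"
    using abs_square_le_1[of d] zero_le_power2[of "c * e' - c' * e"] by (auto simp: abs_le_iff)
  show "0 \<le> \<theta>" "\<theta> \<le> pi"
    using d1 by (simp_all add: d(1) arccos_lbound arccos_ubound)
  show "sin \<theta> = \<bar>c * e' - c' * e\<bar>"
    using d1 by (simp add: d(1) sin_arccos)
qed

lemma not_collinear_geodesic_directions:
  assumes \<sigma>: "geodesic_direction \<sigma> s c e" and \<tau>: "geodesic_direction \<tau> t c' e'" and eq: "\<sigma> s = \<tau> t"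
    and nc: "\<not> collinear {0, velocity \<sigma> s, velocity \<tau> t}"
  shows "c * e' - c' * e \<noteq> 0"
proof
  assume 0: "c * e' - c' * e = 0"
  have unit: "c\<^sup>2 + e\<^sup>2 = 1"
    using \<sigma> by (simp add: geodesic_direction_def)
  \<comment> \<open>With zero determinant, \<open>(c', e')\<close> equals its projection onto the
    unit vector \<open>(c, e)\<close>.\<close>
  have "(c * c' + e * e') * c = c'" "(c * c' + e * e') * e = e'"
    using 0 unit by algebra+
  then have "Complex c' e' = (c * c' + e * e') *\<^sub>R Complex c e"
    by (simp add: complex_eq_iff)
  then have "velocity \<tau> t = (c * c' + e * e') *\<^sub>R velocity \<sigma> s"
    by (simp add: geodesic_direction_velocity[OF \<sigma>] geodesic_direction_velocity[OF \<tau>] eq)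
  then show False
    using nc by (auto simp: collinear_lemma)
qed

theorem corollary5p7:
  fixes \<Gamma> :: "(hyp_plane \<Rightarrow> hyp_plane) set"
    and \<gamma> \<delta> :: "real \<Rightarrow> hyp_plane set"
    and l\<^sub>\<gamma> l\<^sub>\<delta> \<theta> :: real
  assumes "orientable_hyperbolic_surface_group \<Gamma>"
    and "closed_geodesic \<Gamma> \<gamma> l\<^sub>\<gamma>"
    and "closed_geodesic \<Gamma> \<delta> l\<^sub>\<delta>"
    and "intersection_angle \<Gamma> \<gamma> \<delta> \<theta>"
  shows "\<theta> > 2 * parallelism_angle ((l\<^sub>\<gamma> + l\<^sub>\<delta>) / 2)"
proof -
  have G: "isometry_group \<Gamma>" "discrete \<Gamma>"
    using assms(1) by (simp_all add: orientable_hyperbolic_surface_group_def hyperbolic_surface_group_def)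
  have l: "l\<^sub>\<gamma> > 0" "l\<^sub>\<delta> > 0" and per: "\<And>t. \<gamma> (t + l\<^sub>\<gamma>) = \<gamma> t" "\<And>t. \<delta> (t + l\<^sub>\<delta>) = \<delta> t"
    using assms(2,3) by (simp_all add: closed_geodesic_def)
  obtain \<sigma> \<tau> s t where lift: "geodesic_lift \<Gamma> \<gamma> \<sigma>" "geodesic_lift \<Gamma> \<delta> \<tau>"
    and eq: "\<sigma> s = \<tau> t" and nc: "\<not> collinear {0, velocity \<sigma> s, velocity \<tau> t}"
    and \<theta>: "\<theta> = vector_angle (velocity \<sigma> s) (velocity \<tau> t) \<or> \<theta> = vector_angle (velocity \<sigma> s) (- velocity \<tau> t)"
    using assms(4) unfolding intersection_angle_def by blast
  have geo: "geodesic_line \<sigma>" "geodesic_line \<tau>"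
    using lift by (simp_all add: geodesic_lift_def)
  obtain c e where \<sigma>: "geodesic_direction \<sigma> s c e"
    using geodesic_direction_exists[OF geo(1)] .
  obtain c' e' where \<tau>: "geodesic_direction \<tau> t c' e'"
    using geodesic_direction_exists[OF geo(2)] .
  obtain g where g: "g \<in> \<Gamma>" "\<And>t. g (\<sigma> t) = \<sigma> (t + l\<^sub>\<gamma>)"
    using closed_geodesic_translation[OF G lift(1) per(1)] by blast
  obtain h where h: "h \<in> \<Gamma>" "\<And>t. h (\<tau> t) = \<tau> (t + l\<^sub>\<delta>)"
    using closed_geodesic_translation[OF G lift(2) per(2)] by blast
  have "1 \<le> sinh (l\<^sub>\<gamma> / 2) * sinh (l\<^sub>\<delta> / 2) * sin \<theta>"
    using crossing_translations_sinh_bound[OF assms(1) geo(1) \<sigma> geo(2) \<tau> eq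
        not_collinear_geodesic_directions[OF \<sigma> \<tau> eq nc] g h l]
    by (simp add: intersection_angle_sin(3)[OF \<sigma> \<tau> eq \<theta>])
  then have "2 * parallelism_angle (l\<^sub>\<gamma> / 2 + l\<^sub>\<delta> / 2) < \<theta>"
    using l intersection_angle_sin(1,2)[OF \<sigma> \<tau> eq \<theta>] by (intro parallelism_angle_less) simp_all
  then show ?thesis
    by (simp add: add_divide_distrib)
qed

end
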